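(* Let $n\ge2$ and let $w\in C^2(B(0,2)\setminus\{0\})$ be nonnegative and satisfy $-\Delta_n w=f(x,w,\nabla w)$ in $B(0,2)\setminus\{0\}\subset\mathbb{R}^n$, with $\lim_{x\to0}w(x)=+\infty$, where $f$ satisfies \[ 0\le f(x,w,\nabla w)\le C|\nabla w|^{n-2}e^{2w} \] for some fixed constant $C$. Then \[ \lim_{x\to0}\frac{w(x)}{\log\frac1{|x|}}=m\ge 0 \] and there is a constant $L$ with $w(x)\ge m\log\frac1{|x|}-L$ for $x\in B(0,1)\setminus\{0\}$.
   Context: $\Delta_n u=\mathrm{div}(|\nabla u|^{n-2}\nabla u)$ is the $n$-Laplacian. *)

theory Defs
  imports "HOL-Analysis.Analysis"
begin

definition grad :: "(real^'n \<Rightarrow> real) \<Rightarrow> real^'n \<Rightarrow> real^'n" where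
  "grad w x = (\<chi> i. frechet_derivative w (at x) (axis i 1))"

definition divergence :: "(real^'n \<Rightarrow> real^'n) \<Rightarrow> real^'n \<Rightarrow> real" where
  "divergence V x = (\<Sum>i\<in>UNIV. frechet_derivative V (at x) (axis i 1) $ i)"

definition n_laplacian :: "(real^'n \<Rightarrow> real) \<Rightarrow> real^'n \<Rightarrow> real" where
  "n_laplacian w x =
     divergence (\<lambda>y. (norm (grad w y) ^ (CARD('n) - 2)) *\<^sub>R grad w y) x"

definition C2_on :: "(real^'n) set \<Rightarrow> (real^'n \<Rightarrow> real) \<Rightarrow> bool" where
  "C2_on S w \<longleftrightarrow> (\<exists>Dw D2w.
      (\<forall>x\<in>S. (w has_derivative (\<lambda>h. Dw x \<bullet> h)) (at x)) \<and>
      (\<forall>x\<in>S. (Dw has_derivative (\<lambda>h. D2w x *v h)) (at x)) \<and>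
      continuous_on S (D2w :: real^'n \<Rightarrow> real^'n^'n))"

end

theory Submission
  imports Defs
begin

text \<open>
  Where the gradient $p$ of $w$ does not vanish, the equation divided by $|p|^{n-2}$ says
  $-Ce^{2w} \le \Delta w + (n-2) D^2w(p,p)/|p|^2 \le 0$. Everything is derived pointwise from these
  inequalities by maximum-principle arguments in which the gradient of the test function, hence of
  $w$ at the touching point, is nonzero.

  Comparison with logarithms makes $\mu(t) = \min_{|x|=e^{-t}} w$ concave and nonnegative, hence
  $\mu$ has an asymptotic slope $m \ge 0$ and $\mu(t) \ge mt$; this is the lower bound. For the upper
  bound, $w$ cannot exceed $\mu$ by much on a whole ball $B(x,r)$: a gain there would spread to the
  entire sphere through $x$ by a chain of exponential barriers, although $w$ equals $\mu$ somewhere on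
  that sphere; so $\min_{B(x,r)} w \le \mu + O(1) + \sigma\log(|x|/r)$ with $\sigma$ arbitrarily small.
  On the other hand, at the scale $r \approx e^{-w}$, found by maximising
  $e^{w(y)}\,(|x|/2-|y-x|)$, the rescaled function $w/w(x)$ has bounded normalised Laplacian and
  therefore (doubling of variables, Ishii and Lions) a modulus of continuity depending only on $n$, so
  $w$ is close to its minimum over a small fraction of the ball.
\<close>

section \<open>The normalised operator and the comparison principle\<close>

text \<open>For n > 2 the equation carries no information at critical points of w, so the
  nonvanishing of the gradient has to be proved for every comparison function along with the strict
  sign of the operator. The logarithm is annihilated by \<open>nlap\<close> only against a radial
  gradient; adding a bump tilts the gradient, and the bump itself must pay for the loss caused by
  the tilt.

  The upper bound closes by absorption. The operator is linear in its second argument and does not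
  see the length of its first, so w may be divided by a constant L; on a ball of radius r with r e^w
  <= 2 the right-hand side becomes at most 4C/L <= 1 after rescaling. At the scale r = e^(-w) both
  errors, the modulus of continuity and the loss e log(|x|/r), are at most e w, which leaves (1 -
  2e) w <= (m + e) log(1/|x|) + O(1). This is why the logarithmic loss is needed with an arbitrarily
  small coefficient.\<close>

text \<open>At $p = 0$ the quotient is $0$ by convention; the value there is never used.\<close>

definition nlap :: "'a::euclidean_space \<Rightarrow> ('a \<Rightarrow> 'a) \<Rightarrow> real" where
  "nlap p X = (\<Sum>b\<in>Basis. b \<bullet> X b) + (real DIM('a) - 2) * (p \<bullet> X p) / (p \<bullet> p)"

text \<open>The Hessian is a family of linear maps instead of matrices, so that everything up to the
  final translation lives in an arbitrary Euclidean space. It enters later only through its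
  quadratic form.\<close>

definition has_grad_hess ::
  "('a::euclidean_space \<Rightarrow> real) \<Rightarrow> ('a \<Rightarrow> 'a) \<Rightarrow> ('a \<Rightarrow> 'a \<Rightarrow> 'a) \<Rightarrow> 'a set \<Rightarrow> bool" where
  "has_grad_hess w D H S \<longleftrightarrow>
     (\<forall>x\<in>S. (w has_derivative (\<lambda>h. D x \<bullet> h)) (at x) \<and> (D has_derivative H x) (at x))"

lemma has_grad_hessD:
  assumes "has_grad_hess w D H S" "x \<in> S"
  shows "(w has_derivative (\<lambda>h. D x \<bullet> h)) (at x)" "(D has_derivative H x) (at x)"
  using assms by (auto simp: has_grad_hess_def)

lemma has_grad_hess_subset:
  "has_grad_hess w D H S \<Longrightarrow> T \<subseteq> S \<Longrightarrow> has_grad_hess w D H T"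
  by (auto simp: has_grad_hess_def)

lemma has_grad_hess_continuous_on:
  assumes "has_grad_hess w D H S"
  shows "continuous_on S w"
  using assms unfolding has_grad_hess_def
  by (meson continuous_at_imp_continuous_on has_derivative_continuous)

lemma has_grad_hess_linear:
  assumes "has_grad_hess w D H S" "x \<in> S"
  shows "linear (H x)"
  using has_grad_hessD(2)[OF assms] has_derivative_linear by blast

section \<open>Gradients and Hessians of sums, affine rescalings and radial functions\<close>

lemma has_grad_hess_add:
  assumes "has_grad_hess f D H S" "has_grad_hess g E K S"
  shows "has_grad_hess (\<lambda>x. f x + g x) (\<lambda>x. D x + E x) (\<lambda>x h. H x h + K x h) S"
  using assms unfolding has_grad_hess_def
  by (auto intro!: derivative_eq_intros simp: inner_add_left)

lemma has_grad_hess_cmult: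
  assumes "has_grad_hess f D H S"
  shows "has_grad_hess (\<lambda>x. k * f x) (\<lambda>x. k *\<^sub>R D x) (\<lambda>x h. k *\<^sub>R H x h) S"
  using assms unfolding has_grad_hess_def
  by (auto intro!: derivative_eq_intros)

lemma has_grad_hess_const: "has_grad_hess (\<lambda>x. k) (\<lambda>x. 0) (\<lambda>x h. 0) S"
  by (auto simp: has_grad_hess_def)

lemma has_grad_hess_affine:
  assumes "has_grad_hess f D H S"
  shows "has_grad_hess (\<lambda>y. k * f (c + r *\<^sub>R y)) (\<lambda>y. (k * r) *\<^sub>R D (c + r *\<^sub>R y))
           (\<lambda>y h. (k * r\<^sup>2) *\<^sub>R H (c + r *\<^sub>R y) h) {y. c + r *\<^sub>R y \<in> S}"
  unfolding has_grad_hess_def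
proof (intro ballI conjI)
  fix y assume "y \<in> {y. c + r *\<^sub>R y \<in> S}"
  then have y: "c + r *\<^sub>R y \<in> S" by simp
  have d: "((\<lambda>y. c + r *\<^sub>R y) has_derivative (\<lambda>h. r *\<^sub>R h)) (at y)"
    by (auto intro!: derivative_eq_intros)
  have lin: "linear (H (c + r *\<^sub>R y))"
    by (rule has_grad_hess_linear[OF assms y])
  show "((\<lambda>y. k * f (c + r *\<^sub>R y)) has_derivative (\<lambda>h. ((k * r) *\<^sub>R D (c + r *\<^sub>R y)) \<bullet> h)) (at y)"
    using has_derivative_mult_right[OF has_derivative_compose[OF d has_grad_hessD(1)[OF assms y]], of k]
    by (simp add: mult.assoc)
  show "((\<lambda>y. (k * r) *\<^sub>R D (c + r *\<^sub>R y)) has_derivative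
          (\<lambda>h. (k * r\<^sup>2) *\<^sub>R H (c + r *\<^sub>R y) h)) (at y)"
    using has_derivative_scaleR_right[OF has_derivative_compose[OF d has_grad_hessD(2)[OF assms y]], of "k * r"]
    by (simp add: linear_cmul[OF lin] power2_eq_square mult.assoc)
qed

text \<open>The profile is taken in the variable u = |y - c|^2, which is a polynomial in y; the norm
  itself never has to be differentiated.\<close>

lemma has_grad_hess_radial:
  assumes F: "\<And>u. 0 < u \<Longrightarrow> (F has_real_derivative F' u) (at u)"
    and F': "\<And>u. 0 < u \<Longrightarrow> (F' has_real_derivative F'' u) (at u)"
  shows "has_grad_hess (\<lambda>y. F ((y - c) \<bullet> (y - c))) (\<lambda>y. (2 * F' ((y - c) \<bullet> (y - c))) *\<^sub>R (y - c))
     (\<lambda>y h. (2 * F' ((y - c) \<bullet> (y - c))) *\<^sub>R h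
            + (4 * F'' ((y - c) \<bullet> (y - c)) * ((y - c) \<bullet> h)) *\<^sub>R (y - c)) (- {c})"
  unfolding has_grad_hess_def
proof (intro ballI conjI)
  fix y assume "y \<in> - {c}"
  then have pos: "0 < (y - c) \<bullet> (y - c)" by simp
  have q: "((\<lambda>y. (y - c) \<bullet> (y - c)) has_derivative (\<lambda>h. 2 * ((y - c) \<bullet> h))) (at y)"
    by (auto intro!: derivative_eq_intros simp: inner_commute)
  show "((\<lambda>y. F ((y - c) \<bullet> (y - c))) has_derivative
      (\<lambda>h. ((2 * F' ((y - c) \<bullet> (y - c))) *\<^sub>R (y - c)) \<bullet> h)) (at y)"
    using DERIV_compose_FDERIV[OF F[OF pos] q] by (simp add: mult_ac)
  have "((\<lambda>y. F' ((y - c) \<bullet> (y - c))) has_derivative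
      (\<lambda>h. 2 * ((y - c) \<bullet> h) * F'' ((y - c) \<bullet> (y - c)))) (at y)"
    by (rule DERIV_compose_FDERIV[OF F'[OF pos] q])
  then show "((\<lambda>y. (2 * F' ((y - c) \<bullet> (y - c))) *\<^sub>R (y - c)) has_derivative
      (\<lambda>h. (2 * F' ((y - c) \<bullet> (y - c))) *\<^sub>R h
            + (4 * F'' ((y - c) \<bullet> (y - c)) * ((y - c) \<bullet> h)) *\<^sub>R (y - c))) (at y)"
    by (auto intro!: derivative_eq_intros simp: mult_ac)
qed

lemma has_grad_hess_log_norm:
  "has_grad_hess (\<lambda>y. ln (1 / norm (y - c))) (\<lambda>y. - (1 / ((y - c) \<bullet> (y - c))) *\<^sub>R (y - c))
     (\<lambda>y h. - (1 / ((y - c) \<bullet> (y - c))) *\<^sub>R h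
            + (2 / ((y - c) \<bullet> (y - c))\<^sup>2 * ((y - c) \<bullet> h)) *\<^sub>R (y - c)) (- {c})"
proof -
  have "has_grad_hess (\<lambda>y. (\<lambda>u. - (ln u / 2)) ((y - c) \<bullet> (y - c)))
     (\<lambda>y. (2 * (\<lambda>u. - (1 / (2 * u))) ((y - c) \<bullet> (y - c))) *\<^sub>R (y - c))
     (\<lambda>y h. (2 * (\<lambda>u. - (1 / (2 * u))) ((y - c) \<bullet> (y - c))) *\<^sub>R h
            + (4 * (\<lambda>u. 1 / (2 * u\<^sup>2)) ((y - c) \<bullet> (y - c)) * ((y - c) \<bullet> h)) *\<^sub>R (y - c)) (- {c})"
    by (rule has_grad_hess_radial)
       (auto intro!: derivative_eq_intros simp: divide_simps power2_eq_square)
  \<comment> \<open>At the centre both sides are 0 by the conventions \<open>1 / 0 = 0\<close> and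
    \<open>ln 0 = 0\<close>, so the two functions agree everywhere and can be exchanged by
    rewriting.\<close>
  moreover have "- (ln ((y - c) \<bullet> (y - c)) / 2) = ln (1 / norm (y - c))" for y
    by (cases "y = c") (auto simp: ln_div ln_realpow power2_norm_eq_inner[symmetric])
  ultimately show ?thesis by simp
qed

lemma has_grad_hess_norm_sq:
  "has_grad_hess (\<lambda>y. (y - c) \<bullet> (y - c)) (\<lambda>y. 2 *\<^sub>R (y - c)) (\<lambda>y h. 2 *\<^sub>R h) S"
  unfolding has_grad_hess_def
  by (auto intro!: derivative_eq_intros simp: inner_commute)

lemma has_grad_hess_exp_norm_sq:
  "has_grad_hess (\<lambda>y. exp (- (k * ((y - c) \<bullet> (y - c)))))
     (\<lambda>y. - (2 * k * exp (- (k * ((y - c) \<bullet> (y - c))))) *\<^sub>R (y - c))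
     (\<lambda>y h. - (2 * k * exp (- (k * ((y - c) \<bullet> (y - c))))) *\<^sub>R h
       + (4 * k\<^sup>2 * exp (- (k * ((y - c) \<bullet> (y - c)))) * ((y - c) \<bullet> h)) *\<^sub>R (y - c)) (- {c})"
proof -
  have "has_grad_hess (\<lambda>y. (\<lambda>u. exp (- (k * u))) ((y - c) \<bullet> (y - c)))
     (\<lambda>y. (2 * (\<lambda>u. - (k * exp (- (k * u)))) ((y - c) \<bullet> (y - c))) *\<^sub>R (y - c))
     (\<lambda>y h. (2 * (\<lambda>u. - (k * exp (- (k * u)))) ((y - c) \<bullet> (y - c))) *\<^sub>R h
       + (4 * (\<lambda>u. k\<^sup>2 * exp (- (k * u))) ((y - c) \<bullet> (y - c)) * ((y - c) \<bullet> h)) *\<^sub>R (y - c)) (- {c})"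
    by (rule has_grad_hess_radial)
       (auto intro!: derivative_eq_intros simp: power2_eq_square)
  then show ?thesis by (simp add: mult.assoc)
qed

lemma has_grad_hess_sqrt_norm:
  "has_grad_hess (\<lambda>y. sqrt (norm (y - c)))
     (\<lambda>y. (((y - c) \<bullet> (y - c)) powr (- 3/4) / 2) *\<^sub>R (y - c))
     (\<lambda>y h. (((y - c) \<bullet> (y - c)) powr (- 3/4) / 2) *\<^sub>R h
       - (3/4 * ((y - c) \<bullet> (y - c)) powr (- 7/4) * ((y - c) \<bullet> h)) *\<^sub>R (y - c)) (- {c})"
proof -
  have "has_grad_hess (\<lambda>y. (\<lambda>u. u powr (1/4)) ((y - c) \<bullet> (y - c)))
     (\<lambda>y. (2 * (\<lambda>u. u powr (-3/4) / 4) ((y - c) \<bullet> (y - c))) *\<^sub>R (y - c))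
     (\<lambda>y h. (2 * (\<lambda>u. u powr (-3/4) / 4) ((y - c) \<bullet> (y - c))) *\<^sub>R h
       + (4 * (\<lambda>u. - (3/16) * u powr (-7/4)) ((y - c) \<bullet> (y - c)) * ((y - c) \<bullet> h)) *\<^sub>R (y - c)) (- {c})"
  proof (rule has_grad_hess_radial)
    fix u :: real assume u: "0 < u"
    show "((\<lambda>u. u powr (1/4)) has_real_derivative u powr (-3/4) / 4) (at u)"
      using has_real_derivative_powr[OF u, of "1/4"] by simp
    show "((\<lambda>u. u powr (-3/4) / 4) has_real_derivative - (3/16) * u powr (-7/4)) (at u)"
      using DERIV_cdivide[OF has_real_derivative_powr[OF u, of "-3/4"], of 4] by simp
  qed
  moreover have "((y - c) \<bullet> (y - c)) powr (1/4) = sqrt (norm (y - c))" for y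
  proof -
    have "((y - c) \<bullet> (y - c)) powr (1/4) = (norm (y - c) powr 2) powr (1/4)"
      by (simp add: power2_norm_eq_inner[symmetric])
    then show ?thesis unfolding powr_powr by (simp add: powr_half_sqrt)
  qed
  ultimately show ?thesis by simp
qed

section \<open>Necessary conditions at a maximum\<close>

text \<open>The derivative g' is differentiable at 0 only. If D were positive, g' would be positive
  just to the right of 0, and the mean value theorem would make g exceed \<open>g 0\<close>
  there.\<close>

lemma second_derivative_test_max:
  fixes g g' :: "real \<Rightarrow> real"
  assumes d: "0 < d" and g: "\<And>s. \<bar>s\<bar> < d \<Longrightarrow> (g has_real_derivative g' s) (at s)"
    and g': "(g' has_real_derivative D) (at 0)"
    and max: "\<And>s. \<bar>s\<bar> < d \<Longrightarrow> g s \<le> g 0"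
  shows "g' 0 = 0" "D \<le> 0"
proof -
  show g0: "g' 0 = 0"
    by (rule DERIV_local_max[OF g d]) (use d max in auto)
  show "D \<le> 0"
  proof (rule ccontr)
    assume "\<not> D \<le> 0"
    then obtain e where e: "0 < e" "\<And>h. 0 < h \<Longrightarrow> h < e \<Longrightarrow> g' 0 < g' h"
      using DERIV_pos_inc_right[OF g'] by auto
    define s where "s = min d e / 2"
    have s: "0 < s" "s < d" "s < e" using d e(1) by (auto simp: s_def)
    then obtain z where z: "0 < z" "z < s" "g s - g 0 = (s - 0) * g' z"
      using MVT2[of 0 s g g'] g by fastforce
    then have "0 < g s - g 0" using e(2)[of z] s g0 by simp
    with max[of s] s show False by simp
  qed
qed

lemma has_grad_hess_along_line:
  assumes "has_grad_hess w D H S" "open S" "x \<in> S"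
  shows "\<exists>d>0. (\<forall>s. \<bar>s\<bar> < d \<longrightarrow> x + s *\<^sub>R h \<in> S \<and>
           ((\<lambda>s. w (x + s *\<^sub>R h)) has_real_derivative (D (x + s *\<^sub>R h) \<bullet> h)) (at s))"
    and "((\<lambda>s. D (x + s *\<^sub>R h) \<bullet> h) has_real_derivative (h \<bullet> H x h)) (at 0)"
proof -
  have line: "((\<lambda>s. x + s *\<^sub>R h) has_derivative (\<lambda>s. s *\<^sub>R h)) (at s)" for s
    by (auto intro!: derivative_eq_intros)
  obtain e where e: "e > 0" "ball x e \<subseteq> S" using assms(2,3) openE by blast
  define d where "d = e / (norm h + 1)"
  have "d > 0" using e by (simp add: d_def add_nonneg_pos)
  moreover have "x + s *\<^sub>R h \<in> S" if "\<bar>s\<bar> < d" for s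
  proof -
    have "\<bar>s\<bar> * norm h \<le> \<bar>s\<bar> * (norm h + 1)" by (simp add: mult_left_mono)
    also have "\<dots> < e" using that by (simp add: d_def pos_less_divide_eq add_nonneg_pos)
    finally show ?thesis using e(2) by (auto simp: dist_norm)
  qed
  moreover have "((\<lambda>s. w (x + s *\<^sub>R h)) has_real_derivative (D (x + s *\<^sub>R h) \<bullet> h)) (at s)"
    if "x + s *\<^sub>R h \<in> S" for s
    using has_derivative_compose[OF line has_grad_hessD(1)[OF assms(1) that]]
    by (simp add: has_field_derivative_def mult.commute[of _ "D (x + s *\<^sub>R h) \<bullet> h"])
  ultimately show "\<exists>d>0. (\<forall>s. \<bar>s\<bar> < d \<longrightarrow> x + s *\<^sub>R h \<in> S \<and>
           ((\<lambda>s. w (x + s *\<^sub>R h)) has_real_derivative (D (x + s *\<^sub>R h) \<bullet> h)) (at s))"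
    by blast
  have lin: "linear (H x)" by (rule has_grad_hess_linear[OF assms(1,3)])
  have "(D has_derivative H x) (at (x + 0 *\<^sub>R h))"
    using has_grad_hessD(2)[OF assms(1,3)] by simp
  from has_derivative_inner_left[OF has_derivative_compose[OF line this], of h]
  show "((\<lambda>s. D (x + s *\<^sub>R h) \<bullet> h) has_real_derivative (h \<bullet> H x h)) (at 0)"
    by (simp add: has_field_derivative_def linear_cmul[OF lin] inner_commute mult_commute_abs)
qed

lemma local_max_grad_hess:
  assumes gh: "has_grad_hess w D H S" and S: "open S" and x: "x \<in> S"
    and max: "\<And>y. y \<in> S \<Longrightarrow> w y \<le> w x"
  shows "D x = 0" "h \<bullet> H x h \<le> 0"
proof -
  have *: "D x \<bullet> h = 0 \<and> h \<bullet> H x h \<le> 0" for h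
  proof -
    obtain d where d: "d > 0"
      "\<And>s. \<bar>s\<bar> < d \<Longrightarrow> x + s *\<^sub>R h \<in> S"
      "\<And>s. \<bar>s\<bar> < d \<Longrightarrow> ((\<lambda>s. w (x + s *\<^sub>R h)) has_real_derivative (D (x + s *\<^sub>R h) \<bullet> h)) (at s)"
      using has_grad_hess_along_line(1)[OF gh S x] by metis
    show ?thesis
      using second_derivative_test_max[OF d(1,3) has_grad_hess_along_line(2)[OF gh S x]] max d(2)
      by simp
  qed
  show "D x = 0" using *[of "D x"] by simp
  show "h \<bullet> H x h \<le> 0" using * by blast
qed

section \<open>Algebra of the normalised operator and its values on the test functions\<close>

text \<open>Ellipticity: the operator is a trace against the identity plus n - 2 times the
  projection onto p, and dimension at least 2 makes these weights nonnegative.\<close>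

lemma nlap_mono:
  fixes p :: "'a::euclidean_space"
  assumes "2 \<le> DIM('a)" "\<And>h. h \<bullet> X h \<le> h \<bullet> Y h"
  shows "nlap p X \<le> nlap p Y"
  unfolding nlap_def
  using assms by (intro add_mono sum_mono divide_right_mono mult_left_mono) auto

lemma nlap_add: "nlap p (\<lambda>h. X h + Y h) = nlap p X + nlap p Y"
  by (simp add: nlap_def inner_add_right sum.distrib add_divide_distrib distrib_left)

lemma nlap_cmult: "nlap p (\<lambda>h. k *\<^sub>R X h) = k * nlap p X"
  by (simp add: nlap_def sum_distrib_left distrib_left)

lemma nlap_scale_left: "k \<noteq> 0 \<Longrightarrow> linear X \<Longrightarrow> nlap (k *\<^sub>R p) X = nlap p X"
  by (simp add: nlap_def linear_cmul)

text \<open>Hessians of radial functions have exactly this form, so this one formula evaluates the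
  logarithm, the quadratic perturbation and the exponential bump.\<close>

lemma nlap_id_plus_rank_one:
  fixes p z :: "'a::euclidean_space"
  assumes "p \<noteq> 0"
  shows "nlap p (\<lambda>h. a *\<^sub>R h + (b * (z \<bullet> h)) *\<^sub>R z)
         = a * (2 * real DIM('a) - 2) + b * (z \<bullet> z + (real DIM('a) - 2) * (p \<bullet> z)\<^sup>2 / (p \<bullet> p))"
proof -
  have "(\<Sum>i\<in>Basis. i \<bullet> (a *\<^sub>R i + (b * (z \<bullet> i)) *\<^sub>R z)) = a * real DIM('a) + b * (z \<bullet> z)"
    by (simp add: inner_add_right sum.distrib euclidean_inner[of z z] sum_distrib_left mult_ac inner_commute)
  moreover have "(p \<bullet> (a *\<^sub>R p + (b * (z \<bullet> p)) *\<^sub>R z)) / (p \<bullet> p) = a + b * (p \<bullet> z)\<^sup>2 / (p \<bullet> p)"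
    using assms by (simp add: inner_add_right add_divide_distrib inner_commute power2_eq_square)
  ultimately show ?thesis
    unfolding nlap_def times_divide_eq_right[symmetric] by (simp add: algebra_simps)
qed

text \<open>The bracket is the squared sine of the angle between p and z. It vanishes for p parallel
  to z, which is the n-harmonicity of the logarithm; the general form is needed when a bump is added
  and the gradient is no longer radial.\<close>

lemma nlap_log_norm:
  fixes p z :: "'a::euclidean_space"
  assumes "p \<noteq> 0" "z \<noteq> 0"
  shows "nlap p (\<lambda>h. - (1 / (z \<bullet> z)) *\<^sub>R h + (2 / (z \<bullet> z)\<^sup>2 * (z \<bullet> h)) *\<^sub>R z)
         = - (2 * (real DIM('a) - 2) / (z \<bullet> z) * (1 - (p \<bullet> z)\<^sup>2 / ((p \<bullet> p) * (z \<bullet> z))))"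
proof -
  have "- (1 / q) * (2 * n - 2) + 2 / q\<^sup>2 * (q + (n - 2) * u / v) = - (2 * (n - 2) / q * (1 - u / (v * q)))"
    if "q \<noteq> 0" "v \<noteq> 0" for q n u v :: real
    using that by (simp add: field_simps power2_eq_square)
  then show ?thesis
    unfolding nlap_id_plus_rank_one[OF assms(1)] using assms by simp
qed

text \<open>At a positive maximum of \<open>\<phi> - w\<close> the gradients agree and the Hessians
  are ordered. Nonvanishing of E transfers to D, which is what makes the inequality for w available
  at that point; strictness for \<open>\<phi>\<close> then gives the contradiction.\<close>

lemma comparison_principle:
  fixes w \<phi> :: "'a::euclidean_space \<Rightarrow> real"
  assumes dim: "2 \<le> DIM('a)" and K: "compact K" "U \<subseteq> K" and U: "open U"
    and cont: "continuous_on K w" "continuous_on K \<phi>"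
    and w: "has_grad_hess w D H U" and \<phi>: "has_grad_hess \<phi> E J U"
    and super: "\<And>x. x \<in> U \<Longrightarrow> D x \<noteq> 0 \<Longrightarrow> nlap (D x) (H x) \<le> 0"
    and sub: "\<And>x. x \<in> U \<Longrightarrow> E x \<noteq> 0 \<and> nlap (E x) (J x) > 0"
    and bdry: "\<And>x. x \<in> K - U \<Longrightarrow> \<phi> x \<le> w x"
    and x: "x \<in> K"
  shows "\<phi> x \<le> w x"
proof -
  obtain y where y: "y \<in> K" "\<And>z. z \<in> K \<Longrightarrow> \<phi> z - w z \<le> \<phi> y - w y"
    using continuous_attains_sup[OF K(1), of "\<lambda>z. \<phi> z - w z"] x cont
    by (auto intro: continuous_on_diff)
  have "\<phi> y - w y \<le> 0"
  proof (rule ccontr)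
    assume "\<not> \<phi> y - w y \<le> 0"
    then have yU: "y \<in> U" using bdry[of y] y(1) by auto
    have gh: "has_grad_hess (\<lambda>z. \<phi> z + (-1) * w z) (\<lambda>z. E z + (-1) *\<^sub>R D z)
        (\<lambda>z h. J z h + (-1) *\<^sub>R H z h) U"
      by (intro has_grad_hess_add has_grad_hess_cmult w \<phi>)
    have max: "\<phi> z + (-1) * w z \<le> \<phi> y + (-1) * w y" if "z \<in> U" for z
      using y(2)[of z] that K(2) by auto
    have "E y = D y" using local_max_grad_hess(1)[OF gh U yU max] by simp
    moreover have "nlap (E y) (J y) \<le> nlap (E y) (H y)"
      using local_max_grad_hess(2)[OF gh U yU max]
      by (intro nlap_mono dim) (simp add: inner_diff_right)
    ultimately show False using super[OF yU] sub[OF yU] by auto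
  qed
  with y(2)[OF x] show ?thesis by simp
qed

locale n_superharmonic =
  fixes w :: "'a::euclidean_space \<Rightarrow> real" and D H S
  assumes dim: "2 \<le> DIM('a)" and open_domain: "open S" and grad_hess: "has_grad_hess w D H S"
    and super: "\<And>x. x \<in> S \<Longrightarrow> D x \<noteq> 0 \<Longrightarrow> nlap (D x) (H x) \<le> 0"
begin

text \<open>The logarithm is an exact solution, hence not a strict subsolution, and for b = 0 its
  gradient vanishes. Adding t |y - c|^2 repairs both and keeps the gradient radial; then t tends to
  0.\<close>

lemma log_comparison_annulus:
  assumes r: "0 < r1" "r1 \<le> r2" and sub: "cball c r2 - ball c r1 \<subseteq> S"
    and inner: "\<And>y. norm (y - c) = r1 \<Longrightarrow> a + b * ln (1 / r1) \<le> w y"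
    and outer: "\<And>y. norm (y - c) = r2 \<Longrightarrow> a + b * ln (1 / r2) \<le> w y"
    and x: "r1 \<le> norm (x - c)" "norm (x - c) \<le> r2"
  shows "a + b * ln (1 / norm (x - c)) \<le> w x"
proof -
  have perturbed: "a + b * ln (1 / norm (x - c)) + t * ((x - c) \<bullet> (x - c)) - t * r2\<^sup>2 \<le> w x"
    if t: "0 < t" "b \<le> 0 \<or> 2 * t * r2\<^sup>2 < b" for t
  proof -
    let ?q = "\<lambda>y. (y - c) \<bullet> (y - c)"
    \<comment> \<open>Subtracting \<open>t * r2\<^sup>2\<close> makes the perturbation nonpositive
      on the whole annulus, so the boundary inequalities survive.\<close>
    let ?phi = "\<lambda>y. (b * ln (1 / norm (y - c)) + t * ?q y) + (a - t * r2\<^sup>2)"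
    let ?E = "\<lambda>y. (b *\<^sub>R (- (1 / ?q y) *\<^sub>R (y - c)) + t *\<^sub>R (2 *\<^sub>R (y - c))) + 0"
    let ?JL = "\<lambda>y h. - (1 / ?q y) *\<^sub>R h + (2 / (?q y)\<^sup>2 * ((y - c) \<bullet> h)) *\<^sub>R (y - c)"
    let ?J = "\<lambda>y h. (b *\<^sub>R ?JL y h + t *\<^sub>R (2 *\<^sub>R h)) + 0"
    let ?K = "cball c r2 - ball c r1" and ?U = "ball c r2 - cball c r1"
    have gh: "has_grad_hess ?phi ?E ?J (- {c})"
      by (intro has_grad_hess_add has_grad_hess_cmult has_grad_hess_const has_grad_hess_log_norm
          has_grad_hess_norm_sq)
    have Kc: "?K \<subseteq> - {c}" using r by auto
    have "?phi x \<le> w x"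
    proof (rule comparison_principle[OF dim, where K = ?K and U = ?U and E = ?E and J = ?J])
      show "compact ?K" by (intro compact_diff) auto
      show "?U \<subseteq> ?K" by auto
      show "open ?U" by auto
      show "continuous_on ?K w"
        using has_grad_hess_continuous_on[OF grad_hess] sub continuous_on_subset by blast
      show "continuous_on ?K ?phi"
        using has_grad_hess_continuous_on[OF gh] Kc continuous_on_subset by blast
      show "has_grad_hess w D H ?U"
        by (rule has_grad_hess_subset[OF grad_hess]) (use sub in auto)
      show "has_grad_hess ?phi ?E ?J ?U"
        by (rule has_grad_hess_subset[OF gh]) (use r in auto)
      show "nlap (D y) (H y) \<le> 0" if "y \<in> ?U" "D y \<noteq> 0" for y
      proof -
        have "y \<in> S" using that(1) sub by auto
        with super that(2) show ?thesis by blast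
      qed
      show "?phi y \<le> w y" if "y \<in> ?K - ?U" for y
      proof -
        have "norm (y - c) = r1 \<or> norm (y - c) = r2"
          using that by (auto simp: dist_norm norm_minus_commute)
        moreover have "t * r1\<^sup>2 \<le> t * r2\<^sup>2" using r t by (simp add: power_mono)
        ultimately show ?thesis
          using inner[of y] outer[of y] by (auto simp: power2_norm_eq_inner[symmetric])
      qed
      show "x \<in> ?K" using x by (auto simp: dist_norm norm_minus_commute)
      show "?E y \<noteq> 0 \<and> 0 < nlap (?E y) (?J y)" if y: "y \<in> ?U" for y
      proof -
        have q: "0 < ?q y" "?q y < r2\<^sup>2" and yc: "y \<noteq> c"
          using y r
          by (auto simp: dist_norm norm_minus_commute power2_norm_eq_inner[symmetric]
              intro!: power_strict_mono)
        define k where "k = 2 * t - b / ?q y"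
        have E: "?E y = k *\<^sub>R (y - c)" by (simp add: k_def algebra_simps)
        \<comment> \<open>For b > 0 the logarithmic and the quadratic part pull in opposite
          directions; the smallness of t keeps the logarithm dominant up to the outer
          radius.\<close>
        have k: "k \<noteq> 0"
        proof (cases "b \<le> 0")
          case True
          then have "b / ?q y \<le> 0" using q by (simp add: divide_nonpos_pos)
          then show ?thesis using t by (simp add: k_def)
        next
          case False
          then have "2 * t * ?q y < b" using t mult_strict_left_mono[OF q(2), of "2 * t"] by linarith
          then have "2 * t < b / ?q y" using q by (simp add: pos_less_divide_eq)
          then show ?thesis by (simp add: k_def)
        qed
        then have ne: "?E y \<noteq> 0" using E yc by simp
        have "nlap (?E y) (?JL y) = 0"
          using nlap_log_norm[OF ne, of "y - c"] yc k unfolding E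
          by (simp add: power2_eq_square)
        moreover have "nlap (?E y) (\<lambda>h. 2 *\<^sub>R h) = 2 * (2 * real DIM('a) - 2)"
          using nlap_id_plus_rank_one[OF ne, of 2 0] by simp
        ultimately have "nlap (?E y) (?J y) = t * (2 * (2 * real DIM('a) - 2))"
          by (simp only: nlap_add nlap_cmult add_0_right)
        then show ?thesis using ne t dim by simp
      qed
    qed
    then show ?thesis by simp
  qed
  define T where "T = (if b \<le> 0 then 1 else b / (2 * r2\<^sup>2 + 1))"
  have T: "0 < T" "\<And>t. 0 < t \<Longrightarrow> t < T \<Longrightarrow> b \<le> 0 \<or> 2 * t * r2\<^sup>2 < b"
  proof -
    show "0 < T" by (auto simp: T_def add_nonneg_pos)
    fix t :: real assume t: "0 < t" "t < T"
    show "b \<le> 0 \<or> 2 * t * r2\<^sup>2 < b"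
    proof (cases "b \<le> 0")
      case False
      then have "t * (2 * r2\<^sup>2 + 1) < b"
        using t by (simp add: T_def pos_less_divide_eq add_nonneg_pos)
      then show ?thesis using t by (simp add: algebra_simps)
    qed auto
  qed
  have "((\<lambda>t. a + b * ln (1 / norm (x - c)) + t * ((x - c) \<bullet> (x - c)) - t * r2\<^sup>2) \<longlongrightarrow>
      a + b * ln (1 / norm (x - c)) + 0 * ((x - c) \<bullet> (x - c)) - 0 * r2\<^sup>2) (at_right 0)"
    by (intro tendsto_intros)
  moreover have "\<forall>\<^sub>F t in at_right 0.
      a + b * ln (1 / norm (x - c)) + t * ((x - c) \<bullet> (x - c)) - t * r2\<^sup>2 \<le> w x"
    using eventually_at_right_real[OF T(1)] by eventually_elim (use perturbed T(2) in auto)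
  ultimately show ?thesis
    using tendsto_upperbound[of _ "a + b * ln (1 / norm (x - c))" "at_right (0::real)" "w x"] by simp
qed

end

section \<open>Interior modulus of continuity\<close>

text \<open>Both points are moved at once, x along h and y along k, which reduces the claim to one
  real variable. Setting h or k to 0 separates the gradients; the freedom to choose h different from
  k is what later exploits the concavity of the penalty.\<close>

lemma doubled_max_grad_hess:
  fixes u v \<psi> :: "'a::euclidean_space \<Rightarrow> real"
  assumes u: "has_grad_hess u Du Hu S" "open S" "x \<in> S"
    and v: "has_grad_hess v Dv Hv T" "open T" "y \<in> T"
    and \<psi>: "has_grad_hess \<psi> D\<psi> H\<psi> R" "open R" "x - y \<in> R"
    and max: "\<And>x' y'. x' \<in> S \<Longrightarrow> y' \<in> T \<Longrightarrow> u x' - v y' - \<psi> (x' - y') \<le> u x - v y - \<psi> (x - y)"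
  shows "Du x = D\<psi> (x - y)" "Dv y = D\<psi> (x - y)"
    "h \<bullet> Hu x h - k \<bullet> Hv y k \<le> (h - k) \<bullet> H\<psi> (x - y) (h - k)"
proof -
  have *: "Du x \<bullet> h - Dv y \<bullet> k - D\<psi> (x - y) \<bullet> (h - k) = 0 \<and>
      h \<bullet> Hu x h - k \<bullet> Hv y k - (h - k) \<bullet> H\<psi> (x - y) (h - k) \<le> 0" for h k
  proof -
    obtain d1 where d1: "d1 > 0" "\<And>s. \<bar>s\<bar> < d1 \<Longrightarrow> x + s *\<^sub>R h \<in> S"
      "\<And>s. \<bar>s\<bar> < d1 \<Longrightarrow> ((\<lambda>s. u (x + s *\<^sub>R h)) has_real_derivative (Du (x + s *\<^sub>R h) \<bullet> h)) (at s)"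
      using has_grad_hess_along_line(1)[OF u] by metis
    obtain d2 where d2: "d2 > 0" "\<And>s. \<bar>s\<bar> < d2 \<Longrightarrow> y + s *\<^sub>R k \<in> T"
      "\<And>s. \<bar>s\<bar> < d2 \<Longrightarrow> ((\<lambda>s. v (y + s *\<^sub>R k)) has_real_derivative (Dv (y + s *\<^sub>R k) \<bullet> k)) (at s)"
      using has_grad_hess_along_line(1)[OF v] by metis
    obtain d3 where d3: "d3 > 0"
      "\<And>s. \<bar>s\<bar> < d3 \<Longrightarrow> ((\<lambda>s. \<psi> ((x - y) + s *\<^sub>R (h - k))) has_real_derivative
          (D\<psi> ((x - y) + s *\<^sub>R (h - k)) \<bullet> (h - k))) (at s)"
      using has_grad_hess_along_line(1)[OF \<psi>] by metis
    let ?g = "\<lambda>s. u (x + s *\<^sub>R h) - v (y + s *\<^sub>R k) - \<psi> ((x - y) + s *\<^sub>R (h - k))"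
    let ?g' = "\<lambda>s. Du (x + s *\<^sub>R h) \<bullet> h - Dv (y + s *\<^sub>R k) \<bullet> k
        - D\<psi> ((x - y) + s *\<^sub>R (h - k)) \<bullet> (h - k)"
    let ?d = "min d1 (min d2 d3)"
    have "0 < ?d" using d1 d2 d3 by simp
    moreover have "(?g has_real_derivative ?g' s) (at s)" if "\<bar>s\<bar> < ?d" for s
      using that d1 d2 d3 by (intro DERIV_diff) auto
    moreover have "(?g' has_real_derivative
        (h \<bullet> Hu x h - k \<bullet> Hv y k - (h - k) \<bullet> H\<psi> (x - y) (h - k))) (at 0)"
      by (intro DERIV_diff has_grad_hess_along_line(2)[OF u] has_grad_hess_along_line(2)[OF v]
          has_grad_hess_along_line(2)[OF \<psi>])
    moreover have "?g s \<le> ?g 0" if "\<bar>s\<bar> < ?d" for s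
      using max[of "x + s *\<^sub>R h" "y + s *\<^sub>R k"] that d1(2) d2(2) by (simp add: algebra_simps)
    ultimately have "?g' 0 = 0 \<and> h \<bullet> Hu x h - k \<bullet> Hv y k - (h - k) \<bullet> H\<psi> (x - y) (h - k) \<le> 0"
      using second_derivative_test_max[of ?d ?g ?g'] by blast
    then show ?thesis by simp
  qed
  have "(Du x - D\<psi> (x - y)) \<bullet> h = 0" for h using *[of h 0] by (simp add: inner_diff_left)
  then show "Du x = D\<psi> (x - y)" by (metis inner_eq_zero_iff right_minus_eq)
  have "(Dv y - D\<psi> (x - y)) \<bullet> k = 0" for k using *[of 0 k] by (simp add: inner_diff_left)
  then show "Dv y = D\<psi> (x - y)" by (metis inner_eq_zero_iff right_minus_eq)
  show "h \<bullet> Hu x h - k \<bullet> Hv y k \<le> (h - k) \<bullet> H\<psi> (x - y) (h - k)" using *[of h k] by simp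
qed

text \<open>Applied with |p - g| bounded and |g| large, to show that two gradients have almost the
  same direction. The split isolates the change of length from the change of vector; each part is at
  most |p - g| / |g|.\<close>

lemma norm_sgn_diff_le:
  fixes p g :: "'a::euclidean_space"
  assumes "p \<noteq> 0" "g \<noteq> 0"
  shows "norm (sgn p - sgn g) \<le> 2 * norm (p - g) / norm g"
proof -
  have "sgn p - sgn g = (norm g - norm p) *\<^sub>R (p /\<^sub>R (norm p * norm g)) + (p - g) /\<^sub>R norm g"
    using assms by (simp add: sgn_div_norm algebra_simps)
  also have "norm \<dots> \<le> norm ((norm g - norm p) *\<^sub>R (p /\<^sub>R (norm p * norm g))) + norm ((p - g) /\<^sub>R norm g)"
    by (rule norm_triangle_ineq)
  also have "\<dots> = \<bar>norm g - norm p\<bar> / norm g + norm (p - g) / norm g"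
    using assms by (simp add: divide_simps abs_mult)
  also have "\<dots> \<le> 2 * norm (p - g) / norm g"
    using norm_triangle_ineq3[of g p]
    by (simp add: add_divide_distrib[symmetric] divide_right_mono norm_minus_commute)
  finally show ?thesis .
qed

lemma nlap_sgn:
  assumes "linear X" "p \<noteq> 0"
  shows "nlap p X = (\<Sum>b\<in>Basis. b \<bullet> X b) + (real DIM('a) - 2) * (sgn p \<bullet> X (sgn (p::'a::euclidean_space)))"
proof -
  have "sgn p \<bullet> X (sgn p) = (p \<bullet> X p) / (p \<bullet> p)"
    by (simp add: sgn_div_norm linear_cmul[OF assms(1)] power2_norm_eq_inner[symmetric]
        power2_eq_square divide_simps)
  then show ?thesis by (simp add: nlap_def)
qed

text \<open>The map b - 2(e.b)e is an orthogonal involution, so conjugating X by it preserves the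
  trace. In the expansion the multiples of e.Xe are -2, -2 and +4.\<close>

lemma trace_reflection:
  fixes e :: "'a::euclidean_space"
  assumes X: "linear X" and e: "e \<bullet> e = 1"
  shows "(\<Sum>b\<in>Basis. (b - (2 * (e \<bullet> b)) *\<^sub>R e) \<bullet> X (b - (2 * (e \<bullet> b)) *\<^sub>R e)) = (\<Sum>b\<in>Basis. b \<bullet> X b)"
proof -
  have "X (\<Sum>b\<in>Basis. (e \<bullet> b) *\<^sub>R b) = (\<Sum>b\<in>Basis. (e \<bullet> b) *\<^sub>R X b)"
    by (simp add: linear_sum[OF X] linear_cmul[OF X])
  then have Xe: "X e = (\<Sum>b\<in>Basis. (e \<bullet> b) *\<^sub>R X b)"
    by (simp only: euclidean_representation)
  have "(b - (2 * (e \<bullet> b)) *\<^sub>R e) \<bullet> X (b - (2 * (e \<bullet> b)) *\<^sub>R e)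
      = b \<bullet> X b - 2 * (e \<bullet> ((e \<bullet> b) *\<^sub>R X b)) - 2 * ((e \<bullet> b) * (b \<bullet> X e)) + 4 * ((e \<bullet> b)\<^sup>2 * (e \<bullet> X e))"
    for b
    unfolding linear_diff[OF X] linear_cmul[OF X] inner_diff_left inner_diff_right
      inner_scaleR_left inner_scaleR_right
    by (simp add: power2_eq_square algebra_simps)
  then have "(\<Sum>b\<in>Basis. (b - (2 * (e \<bullet> b)) *\<^sub>R e) \<bullet> X (b - (2 * (e \<bullet> b)) *\<^sub>R e))
     = (\<Sum>b\<in>Basis. b \<bullet> X b) - 2 * (e \<bullet> (\<Sum>b\<in>Basis. (e \<bullet> b) *\<^sub>R X b))
       - 2 * (\<Sum>b\<in>Basis. (e \<bullet> b) * (b \<bullet> X e)) + 4 * ((\<Sum>b\<in>Basis. (e \<bullet> b)\<^sup>2) * (e \<bullet> X e))"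
    unfolding inner_sum_right sum_distrib_left sum_distrib_right
    by (simp only: sum.distrib sum_subtractf)
  also have "(\<Sum>b\<in>Basis. (e \<bullet> b) * (b \<bullet> X e)) = e \<bullet> X e"
    using euclidean_inner[of e "X e"] by (simp add: inner_commute)
  also have "(\<Sum>b\<in>Basis. (e \<bullet> b)\<^sup>2) = 1"
    using euclidean_inner[of e e] e by (simp add: power2_eq_square)
  finally show ?thesis by (simp add: Xe[symmetric])
qed

text \<open>
  At a maximum of $v(x) - 4|x|^2 - v(y) - A|x-y|^{1/2}$ the gradients of $v$ at $x$ and $y$ are nonzero
  and nearly parallel to $e = (x-y)/|x-y|$. Testing the Hessians with the pairs $(b, Rb)$, where $R$
  is the reflection in $e^\perp$ and $b$ runs through a basis, displaces only along $e$, the direction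
  in which the penalty is concave; this makes the difference of the traces very negative.
\<close>

lemma sqrt_norm_holder_estimate:
  fixes v :: "'a::euclidean_space \<Rightarrow> real"
  assumes dim: "2 \<le> DIM('a)" and gh: "has_grad_hess v D H S" and S: "cball 0 1 \<subseteq> S"
    and eqn: "\<And>x. x \<in> ball 0 1 \<Longrightarrow> D x \<noteq> 0 \<Longrightarrow> -1 \<le> nlap (D x) (H x) \<and> nlap (D x) (H x) \<le> 0"
    and osc: "\<And>x y. x \<in> cball 0 1 \<Longrightarrow> y \<in> cball 0 1 \<Longrightarrow> v x - v y \<le> 2"
    and y0: "y0 \<in> cball 0 1"
  shows "v 0 - v y0 \<le> 600 * real DIM('a) * sqrt (norm y0)"
proof (rule ccontr)
  assume contra: "\<not> ?thesis"
  define n where "n = real DIM('a)"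
  have n: "2 \<le> n" using dim by (simp add: n_def)
  \<comment> \<open>A must beat the 17 n k produced by the other terms in the final estimate, and be
    at least 512 for the comparison of directions; \<open>A \<ge> 1200\<close> also forces r < 1/16
    and makes the gradients long compared with the shift 8|x|.\<close>
  define A where "A = 600 * n"
  have A: "1200 \<le> A" using n by (simp add: A_def)
  let ?K = "cball (0::'a) 1 \<times> cball (0::'a) 1"
  \<comment> \<open>The term -4|x|^2 vanishes at the base point x = 0, so the negated claim still
    makes the maximum positive. Since the oscillation is at most 2, it also confines x to |x| < 3/4;
    y follows because the penalty keeps it close to x.\<close>
  define \<Phi> where "\<Phi> = (\<lambda>(x, y). (v x + (-4) * (x \<bullet> x)) - v y - A * sqrt (norm (x - y)))"
  have vc: "continuous_on (cball 0 1) v"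
    using has_grad_hess_continuous_on[OF gh] S continuous_on_subset by blast
  have "continuous_on ?K \<Phi>"
    unfolding \<Phi>_def case_prod_unfold
    by (intro continuous_intros continuous_on_compose2[OF vc]) auto
  then obtain xy where xy: "xy \<in> ?K" "\<And>q. q \<in> ?K \<Longrightarrow> \<Phi> q \<le> \<Phi> xy"
    using continuous_attains_sup[of ?K \<Phi>]
    by (metis (no_types) compact_Times compact_cball Times_empty cball_eq_empty not_one_less_zero)
  obtain x y where [simp]: "xy = (x, y)" by (cases xy)
  have xK: "x \<in> cball 0 1" and yK: "y \<in> cball 0 1" using xy(1) by auto
  have max: "\<Phi> (x', y') \<le> \<Phi> (x, y)" if "x' \<in> cball 0 1" "y' \<in> cball 0 1" for x' y'
    using xy(2)[of "(x', y')"] that by simp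
  have "0 < \<Phi> (0, y0)" using contra by (simp add: \<Phi>_def A_def n_def)
  then have pos: "0 < \<Phi> (x, y)" using max[of 0 y0] y0 by simp
  define z where "z = x - y"
  define r where "r = norm z"
  \<comment> \<open>On the diagonal the value is -4|x|^2 <= 0. This matters because the penalty is
    smooth only off the diagonal.\<close>
  have "x \<noteq> y" using pos inner_ge_zero[of y] by (auto simp: \<Phi>_def simp del: inner_ge_zero)
  then have z0: "z \<noteq> 0" and r: "0 < r" by (auto simp: z_def r_def)
  have le2: "4 * (x \<bullet> x) + A * sqrt r < 2"
    using pos osc[OF xK yK] by (simp add: \<Phi>_def r_def z_def)
  have "0 \<le> A * sqrt r" using A r by simp
  then have "(norm x)\<^sup>2 < 1 / 2" using le2 unfolding power2_norm_eq_inner by linarith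
  then have "(norm x)\<^sup>2 < (3/4)\<^sup>2" by (simp add: power2_eq_square)
  then have nx: "norm x < 3/4" by (rule power_less_imp_less_base) simp
  have "1200 * sqrt r \<le> A * sqrt r" using A r by (intro mult_right_mono) auto
  then have "sqrt r < 1/4" using le2 inner_ge_zero[of x] by linarith
  then have "sqrt r < sqrt ((1/4)\<^sup>2)" by simp
  then have r1: "r < 1/16" unfolding real_sqrt_less_iff by (simp add: power2_eq_square)
  have ny: "norm y < 1" using nx r1 norm_triangle_ineq4[of x z] by (simp add: r_def z_def)

  \<comment> \<open>With k = r^(-3/2), the Hessian of |z|^(1/2) has eigenvalue k/2 across z and -k/4
    along z, and its gradient has length k r / 2.\<close>
  define k where "k = (z \<bullet> z) powr (-3/4)"
  have zz: "z \<bullet> z = r\<^sup>2" by (simp add: r_def power2_norm_eq_inner)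
  have k_eq: "k = r powr (-3/2)"
  proof -
    have "z \<bullet> z = r powr 2" using zz r by simp
    then show ?thesis unfolding k_def by (simp only: powr_powr) simp
  qed
  have kz: "(z \<bullet> z) powr (-7/4) = k / (z \<bullet> z)"
  proof -
    have "(z \<bullet> z) powr (-3/4 - 1) = k / (z \<bullet> z)"
      unfolding k_def powr_diff using z0 by simp
    then show ?thesis by simp
  qed
  have "k * r = r powr (-1/2)"
  proof -
    have "r powr (-3/2) * r powr 1 = r powr (-1/2)"
      unfolding powr_add[symmetric] by simp
    then show ?thesis using r by (simp add: k_eq)
  qed
  also have "1 \<le> r powr (-1/2)"
    using powr_mono'[of "-1/2" 0 r] r r1 by simp
  finally have kr: "1 \<le> k * r" .
  have k1: "1 \<le> k" using powr_mono'[of "-3/2" 0 r] r r1 by (simp add: k_eq)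

  let ?Dp = "\<lambda>u::'a. (((u - 0) \<bullet> (u - 0)) powr (- 3/4) / 2) *\<^sub>R (u - 0)"
  let ?Hp = "\<lambda>u h::'a. (((u - 0) \<bullet> (u - 0)) powr (- 3/4) / 2) *\<^sub>R h
       - (3/4 * ((u - 0) \<bullet> (u - 0)) powr (- 7/4) * ((u - 0) \<bullet> h)) *\<^sub>R (u - 0)"
  have ghu: "has_grad_hess (\<lambda>x. v x + (-4) * ((x - 0) \<bullet> (x - 0)))
      (\<lambda>x. D x + (-4) *\<^sub>R (2 *\<^sub>R (x - 0))) (\<lambda>x h. H x h + (-4) *\<^sub>R (2 *\<^sub>R h)) (ball 0 1)"
    using S by (intro has_grad_hess_add has_grad_hess_cmult has_grad_hess_norm_sq
        has_grad_hess_subset[OF gh]) auto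
  have ghv: "has_grad_hess v D H (ball 0 1)"
    using S by (intro has_grad_hess_subset[OF gh]) auto
  have ghp: "has_grad_hess (\<lambda>u::'a. A * sqrt (norm (u - 0))) (\<lambda>u. A *\<^sub>R ?Dp u) (\<lambda>u h. A *\<^sub>R ?Hp u h) (- {0})"
    by (intro has_grad_hess_cmult has_grad_hess_sqrt_norm)
  have prems: "open (ball 0 (1::real))" "x \<in> ball 0 1" "y \<in> ball 0 1" "x - y \<in> - {0}" "open (- {0::'a})"
    using nx ny z0 by (auto simp: z_def)
  have max': "v x' + - 4 * ((x' - 0) \<bullet> (x' - 0)) - v y' - A * sqrt (norm (x' - y' - 0))
      \<le> v x + - 4 * ((x - 0) \<bullet> (x - 0)) - v y - A * sqrt (norm (x - y - 0))"
    if "x' \<in> ball 0 1" "y' \<in> ball 0 1" for x' y'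
    using max[of x' y'] that by (simp add: \<Phi>_def)
  note dm = doubled_max_grad_hess[OF ghu open_ball prems(2) ghv open_ball prems(3) ghp prems(5) prems(4) max',
      folded z_def, simplified]
  define g where "g = D y"
  define p where "p = D x"
  have g_eq: "g = (A * k / 2) *\<^sub>R z" using dm(2) by (simp add: g_def k_def)
  have p_eq: "p - g = 8 *\<^sub>R x" using dm(1,2) by (simp add: g_def p_def algebra_simps)
  have ng: "norm g = A * k * r / 2" using A k1 by (simp add: g_eq r_def)
  have ng_ge: "A / 2 \<le> norm g" using A kr mult_left_mono[OF kr, of A] by (simp add: ng mult.assoc)
  have g0: "g \<noteq> 0" using ng_ge A by auto
  have npg: "norm (p - g) \<le> 8" using nx by (simp add: p_eq)
  have p0: "p \<noteq> 0" using npg ng_ge A by auto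
  define e where "e = sgn z"
  have e: "e \<bullet> e = 1" "z \<bullet> e = r" "sgn g = e"
    using z0 A k1 by (simp_all add: e_def sgn_div_norm g_eq r_def power2_norm_eq_inner[symmetric]
        power2_eq_square inverse_eq_divide)
  have Hp: "h \<bullet> ?Hp z h = k / 2 * (h \<bullet> h) - 3/4 * k / r\<^sup>2 * (z \<bullet> h)\<^sup>2" for h
    unfolding diff_zero unfolding kz k_def[symmetric] unfolding zz
    by (simp add: inner_diff_right power2_eq_square inner_commute)
  have two: "h \<bullet> H x h - k' \<bullet> H y k' \<le> 8 * (h \<bullet> h) + A * ((h - k') \<bullet> ?Hp z (h - k'))" for h k'
    using dm(3)[of h k'] by (simp add: inner_diff_right)
  have linX: "linear (H x)" and linY: "linear (H y)"
    using has_grad_hess_linear[OF ghv] prems by auto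

  have "(\<Sum>b\<in>Basis. b \<bullet> H x b) - (\<Sum>b\<in>Basis. b \<bullet> H y b)
     = (\<Sum>b\<in>Basis. b \<bullet> H x b - (b - (2 * (e \<bullet> b)) *\<^sub>R e) \<bullet> H y (b - (2 * (e \<bullet> b)) *\<^sub>R e))"
    by (simp only: sum_subtractf trace_reflection[OF linY e(1)])
  also have "\<dots> \<le> (\<Sum>b\<in>Basis. 8 + (e \<bullet> b)\<^sup>2 * (- (A * k)))"
  proof (rule sum_mono)
    fix b :: 'a assume b: "b \<in> Basis"
    let ?h = "(2 * (e \<bullet> b)) *\<^sub>R e"
    \<comment> \<open>The displacement 2(e.b)e has squared length 4(e.b)^2 and meets the eigenvalue
      -k/4. The squares (e.b)^2 sum to 1 over the basis, so the total is 8n - Ak.\<close>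
    have "?h \<bullet> ?Hp z ?h = - ((e \<bullet> b)\<^sup>2 * k)"
      unfolding Hp using r e by (simp add: power2_eq_square inner_commute)
    then show "b \<bullet> H x b - (b - ?h) \<bullet> H y (b - ?h) \<le> 8 + (e \<bullet> b)\<^sup>2 * (- (A * k))"
      using two[of b "b - ?h"] b by (simp add: mult_ac)
  qed
  also have "\<dots> = 8 * n - A * k"
    using euclidean_inner[of e e] e(1)
    by (simp add: sum_subtractf sum_distrib_right[symmetric] power2_eq_square n_def)
  finally have tr: "(\<Sum>b\<in>Basis. b \<bullet> H x b) - (\<Sum>b\<in>Basis. b \<bullet> H y b) \<le> 8 * n - A * k" .

  \<comment> \<open>The remaining term of the operator is tested with the two gradient directions.
    They differ by at most 32/A, so even the convex part of the penalty costs only A (k/2) (32/A)^2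
    = 512 k / A <= k.\<close>
  have "norm (sgn p - e) \<le> 16 / norm g"
    using norm_sgn_diff_le[OF p0 g0] npg e(3) divide_right_mono[of "2 * norm (p - g)" 16 "norm g"] by simp
  then have "(norm (sgn p - e))\<^sup>2 \<le> (16 / norm g)\<^sup>2" by (intro power_mono) auto
  also have "(16 / norm g)\<^sup>2 \<le> (32 / A)\<^sup>2"
    using ng_ge A g0 by (intro power_mono) (auto simp: field_simps)
  finally have "A * (k / 2 * ((sgn p - e) \<bullet> (sgn p - e))) \<le> A * (k / 2 * (32 / A)\<^sup>2)"
    using A k1 by (intro mult_left_mono) (auto simp: power2_norm_eq_inner)
  also have "\<dots> = 512 / A * k" using A by (simp add: power2_eq_square)
  also have "\<dots> \<le> 1 * k" using A k1 by (intro mult_right_mono) auto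
  finally have diff: "A * (k / 2 * ((sgn p - e) \<bullet> (sgn p - e))) \<le> k" by simp
  have "A * (0 - 3/4 * k / r\<^sup>2 * (z \<bullet> (sgn p - e))\<^sup>2) \<le> 0"
    using A k1 by (intro mult_nonneg_nonpos) auto
  then have "A * ((sgn p - e) \<bullet> ?Hp z (sgn p - e)) \<le> k"
    unfolding Hp using diff by (simp add: algebra_simps)
  moreover have "sgn p \<bullet> sgn p = 1"
    using p0 by (simp add: power2_norm_eq_inner[symmetric] norm_sgn)
  ultimately have nn: "sgn p \<bullet> H x (sgn p) - e \<bullet> H y e \<le> 8 + k"
    using two[of "sgn p" e] by simp
  have "nlap p (H x) - nlap g (H y) = ((\<Sum>b\<in>Basis. b \<bullet> H x b) - (\<Sum>b\<in>Basis. b \<bullet> H y b))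
      + (n - 2) * (sgn p \<bullet> H x (sgn p) - e \<bullet> H y e)"
    unfolding nlap_sgn[OF linX p0] nlap_sgn[OF linY g0] e(3) n_def by (simp add: algebra_simps)
  also have "\<dots> \<le> (8 * n - A * k) + (n - 2) * (8 + k)"
    using tr nn n by (intro add_mono mult_left_mono) auto
  also have "\<dots> \<le> (8 * n - A * k) + n * (9 * k)"
    using n k1 by (intro add_mono mult_mono) auto
  also have "\<dots> \<le> 8 * (n * k) - A * k + 9 * (n * k)" using n k1 by simp
  also have "\<dots> = - (583 * (n * k))" by (simp add: A_def)
  also have "\<dots> < -1" using mult_mono[of 1 n 1 k] n k1 by simp
  finally have "nlap p (H x) - nlap g (H y) < -1" .
  moreover have "-1 \<le> nlap p (H x)" "nlap g (H y) \<le> 0"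
    using eqn prems p0 g0 by (auto simp: p_def g_def)
  ultimately show False by simp
qed

section \<open>Barriers and propagation of a gain along spheres\<close>

text \<open>The hypothesis \<open>chord\<close> is concavity, so chord slopes decrease to the right.
  A negative slope would persist and drive \<open>\<mu>\<close> below 0. The asymptotic slope is the
  infimum of all chord slopes, and every chord to the right of a nearly optimal one is nearly
  optimal.\<close>

lemma concave_asymptotic_slope:
  fixes \<mu> :: "real \<Rightarrow> real"
  assumes nonneg: "\<And>t. 0 \<le> t \<Longrightarrow> 0 \<le> \<mu> t"
    and chord: "\<And>a b s t u. 0 \<le> s \<Longrightarrow> s \<le> t \<Longrightarrow> t \<le> u \<Longrightarrow>
      a + b * s \<le> \<mu> s \<Longrightarrow> a + b * u \<le> \<mu> u \<Longrightarrow> a + b * t \<le> \<mu> t"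
  obtains m where "0 \<le> m" "\<And>s t. 0 \<le> s \<Longrightarrow> s \<le> t \<Longrightarrow> \<mu> s + m * (t - s) \<le> \<mu> t"
    "\<And>e. 0 < e \<Longrightarrow> \<exists>T\<ge>0. \<forall>s t. T \<le> s \<longrightarrow> s \<le> t \<longrightarrow> \<mu> t \<le> \<mu> s + (m + e) * (t - s)"
proof -
  define sl where "sl = (\<lambda>s t. (\<mu> t - \<mu> s) / (t - s))"
  have sl_eq: "\<mu> t = \<mu> s + sl s t * (t - s)" if "s < t" for s t
    using that by (simp add: sl_def)
  have slopes: "sl t u \<le> sl s t" if "0 \<le> s" "s < t" "t < u" for s t u
  proof -
    have su: "\<mu> s - sl s u * s + sl s u * u = \<mu> u"
      using sl_eq[of s u] that by (simp add: algebra_simps)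
    have "\<mu> s - sl s u * s + sl s u * t \<le> \<mu> t"
      by (rule chord[of s t u]) (use that su in auto)
    then have le: "\<mu> s + sl s u * (t - s) \<le> \<mu> t" by (simp add: algebra_simps)
    then have "sl s u * (t - s) \<le> sl s t * (t - s)" using sl_eq[of s t] that by simp
    then have 1: "sl s u \<le> sl s t" using that by simp
    have "\<mu> t + sl t u * (u - t) = \<mu> s + sl s u * (u - s)"
      using sl_eq[of t u] sl_eq[of s u] that by simp
    then have "sl t u * (u - t) \<le> sl s u * (u - t)" using le by (simp add: algebra_simps)
    then have "sl t u \<le> sl s u" using that by simp
    with 1 show ?thesis by simp
  qed
  have sl_nonneg: "0 \<le> sl s t" if st: "0 \<le> s" "s < t" for s t
  proof (rule ccontr)
    assume neg: "\<not> 0 \<le> sl s t"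
    \<comment> \<open>The abscissa at which the line of slope \<open>sl s t\<close> through the
      point over t reaches -1.\<close>
    define u where "u = t + (\<mu> t + 1) / (- sl s t)"
    have "t < u" using neg nonneg[of t] st by (simp add: u_def divide_pos_neg)
    then have "\<mu> u = \<mu> t + sl t u * (u - t)" and "sl t u * (u - t) \<le> sl s t * (u - t)"
      using sl_eq slopes st by (auto intro: mult_right_mono)
    moreover have "sl s t * (u - t) = - (\<mu> t + 1)" using neg by (simp add: u_def)
    ultimately have "\<mu> u \<le> -1" by simp
    with nonneg[of u] \<open>t < u\<close> st show False by simp
  qed
  define A where "A = {sl s t | s t. 0 \<le> s \<and> s < t}"
  have memA: "sl s t \<in> A" if "0 \<le> s" "s < t" for s t using that unfolding A_def by blast
  have A: "A \<noteq> {}" "bdd_below A"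
    using memA[of 0 1] sl_nonneg by (auto simp: A_def intro!: bdd_belowI[of _ 0])
  show thesis
  proof (rule that[of "Inf A"])
    show "0 \<le> Inf A" using A(1) sl_nonneg by (intro cInf_greatest) (auto simp: A_def)
    show "\<mu> s + Inf A * (t - s) \<le> \<mu> t" if "0 \<le> s" "s \<le> t" for s t
    proof (cases "s = t")
      case False
      with that have "sl s t \<in> A" by (intro memA) auto
      then have "Inf A \<le> sl s t" by (rule cInf_lower[OF _ A(2)])
      then have "Inf A * (t - s) \<le> sl s t * (t - s)" using that by (intro mult_right_mono) auto
      then show ?thesis using sl_eq[of s t] False that by simp
    qed simp
    fix e :: real assume "0 < e"
    then obtain s0 t0 where st: "0 \<le> s0" "s0 < t0" "sl s0 t0 < Inf A + e"
      using cInf_lessD[OF A(1), of "Inf A + e"] by (auto simp: A_def)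
    \<comment> \<open>The shift by 1 makes t0 < s strict, so that the chord from t0 to s can be
      inserted between the two being compared.\<close>
    have "\<mu> t \<le> \<mu> s + (Inf A + e) * (t - s)" if "t0 + 1 \<le> s" "s \<le> t" for s t
    proof (cases "s = t")
      case False
      have "sl s t \<le> sl t0 s" "sl t0 s \<le> sl s0 t0" using slopes that st False by auto
      then have "sl s t * (t - s) \<le> (Inf A + e) * (t - s)"
        using st that by (intro mult_right_mono) auto
      then show ?thesis using sl_eq[of s t] False that by simp
    qed simp
    then show "\<exists>T\<ge>0. \<forall>s t. T \<le> s \<longrightarrow> s \<le> t \<longrightarrow> \<mu> t \<le> \<mu> s + (Inf A + e) * (t - s)"
      using st by (intro exI[of _ "t0 + 1"]) auto
  qed
qed

section \<open>The exponential barrier\<close>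

text \<open>Let s be the squared sine of the angle between E and y. E and d have the same component
  orthogonal to y, so s |E|^2 <= |d|^2; with s <= 1 this yields s |E| <= |d|, whether or not E is
  short. Then m/|y| <= |E| + |d| gives the bound, which is linear in d and independent of m.\<close>

lemma log_hessian_deficit:
  fixes y d :: "'a::euclidean_space"
  assumes E: "E = - (m / (y \<bullet> y)) *\<^sub>R y + d" and ne: "E \<noteq> 0" "y \<noteq> 0" and m: "0 \<le> m"
  shows "m / (y \<bullet> y) * (1 - (E \<bullet> y)\<^sup>2 / ((E \<bullet> E) * (y \<bullet> y))) \<le> 2 * norm d / norm y"
proof -
  define s where "s = 1 - (E \<bullet> y)\<^sup>2 / ((E \<bullet> E) * (y \<bullet> y))"
  have pos: "0 < norm E" "0 < norm y" using ne by auto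
  have "(E \<bullet> y)\<^sup>2 \<le> (E \<bullet> E) * (y \<bullet> y)" by (rule Cauchy_Schwarz_ineq)
  then have s0: "0 \<le> s" using ne by (simp add: s_def)
  have s1: "s \<le> 1" by (simp add: s_def)
  have "(E \<bullet> E) * (y \<bullet> y) - (E \<bullet> y)\<^sup>2 = (d \<bullet> d) * (y \<bullet> y) - (d \<bullet> y)\<^sup>2"
  proof -
    have yy: "y \<bullet> y \<noteq> 0" using ne by simp
    define c where "c = m / (y \<bullet> y)"
    show ?thesis
      unfolding E c_def[symmetric]
      by (simp add: inner_add_left inner_add_right inner_commute[of y d] power2_eq_square algebra_simps)
  qed
  then have "s * ((E \<bullet> E) * (y \<bullet> y)) \<le> (d \<bullet> d) * (y \<bullet> y)"
    using ne by (simp add: s_def left_diff_distrib)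
  then have "s * (E \<bullet> E) \<le> d \<bullet> d" using ne by (simp add: mult.assoc[symmetric])
  then have sE: "s * (norm E)\<^sup>2 \<le> (norm d)\<^sup>2" by (simp add: power2_norm_eq_inner)
  have "norm E * s \<le> norm d"
  proof (cases "norm E \<le> norm d")
    case True
    then show ?thesis using mult_left_mono[OF s1, of "norm E"] by simp
  next
    case False
    have "norm E * (norm E * s) \<le> norm d * norm d" using sE by (simp add: power2_eq_square mult_ac)
    also have "\<dots> \<le> norm E * norm d" using False by (intro mult_right_mono) auto
    finally show ?thesis using pos by simp
  qed
  moreover have "m / norm y \<le> norm E + norm d"
  proof -
    have "m / norm y = norm (E - d)"
      using m pos by (simp add: E power2_norm_eq_inner[symmetric] power2_eq_square)
    then show ?thesis using norm_triangle_ineq4[of E d] by simp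
  qed
  then have "m / norm y * s \<le> (norm E + norm d) * s" using s0 by (intro mult_right_mono)
  moreover have "norm d * s \<le> norm d" using mult_left_mono[OF s1, of "norm d"] by simp
  ultimately have "m / norm y * s \<le> 2 * norm d" by (simp add: algebra_simps)
  then have "m / norm y * s / norm y \<le> 2 * norm d / norm y" using pos by (intro divide_right_mono) auto
  then show ?thesis by (simp add: s_def power2_norm_eq_inner[symmetric] power2_eq_square)
qed

text \<open>
  The barrier is $h - \epsilon + \eta(e^{-3n|z|^2/s^2} - e^{-27n})$ with $z = y - x$. The third condition
  on $\eta$ keeps its gradient away from $0$ when $m > 0$.
\<close>

lemma (in n_superharmonic) barrier_step:
  fixes a m \<epsilon> \<gamma> \<eta> \<rho> s :: real and x :: 'a
  defines "n \<equiv> real DIM('a)" and "h \<equiv> \<lambda>y. a + m * ln (1 / norm y)"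
  assumes s: "0 < s" "6 * s \<le> \<rho>" and x: "norm x = \<rho>" and m: "0 \<le> m"
    and lower: "\<And>y. \<rho> / 2 \<le> norm y \<Longrightarrow> norm y \<le> 2 * \<rho> \<Longrightarrow> y \<in> S \<and> h y - \<epsilon> \<le> w y"
    and gain: "\<And>y. y \<in> cball x s \<Longrightarrow> h y + \<gamma> \<le> w y"
    and \<eta>: "0 < \<eta>" "\<eta> \<le> \<gamma>" "m = 0 \<or> 36 * n * \<eta> * \<rho> < m * s" and \<epsilon>: "0 \<le> \<epsilon>"
    and y: "y \<in> cball x (2 * s)"
  shows "h y + (\<eta> * (exp (- (12 * n)) - exp (- (27 * n))) - \<epsilon>) \<le> w y"
proof (cases "y \<in> cball x s")
  case True
  have n: "2 \<le> n" using dim by (simp add: n_def)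
  have "\<eta> * (exp (- (12 * n)) - exp (- (27 * n))) \<le> \<eta> * 1"
  proof (intro mult_left_mono)
    have "exp (- (12 * n)) \<le> 1" using n by simp
    then show "exp (- (12 * n)) - exp (- (27 * n)) \<le> 1" using exp_gt_zero[of "- (27 * n)"] by linarith
  qed (use \<eta> in simp)
  then show ?thesis using gain[OF True] \<eta>(2) \<epsilon> by linarith
next
  case False
  have n: "2 \<le> n" using dim by (simp add: n_def)
  \<comment> \<open>The exponent is 3n, 12n and 27n at distance s, 2s and 3s. Outside the inner ball
    the bump gains 3n - (n - 1) in units of \<open>4 * \<eta> * \<kappa> * ?e z\<close>, while the
    tilted logarithm loses at most 2(n - 2); the margin is 5.\<close>
  define \<kappa> where "\<kappa> = 3 * n / s\<^sup>2"
  have \<kappa>: "0 < \<kappa>" using n s by (simp add: \<kappa>_def)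
  let ?e = "\<lambda>y. exp (- (\<kappa> * ((y - x) \<bullet> (y - x))))"
  let ?phi = "\<lambda>y. (m * ln (1 / norm (y - 0)) + \<eta> * ?e y) + (a - \<epsilon> - \<eta> * exp (- (27 * n)))"
  let ?JL = "\<lambda>y h. - (1 / ((y - 0) \<bullet> (y - 0))) *\<^sub>R h
      + (2 / ((y - 0) \<bullet> (y - 0))\<^sup>2 * ((y - 0) \<bullet> h)) *\<^sub>R (y - 0)"
  let ?JE = "\<lambda>y h. - (2 * \<kappa> * ?e y) *\<^sub>R h + (4 * \<kappa>\<^sup>2 * ?e y * ((y - x) \<bullet> h)) *\<^sub>R (y - x)"
  let ?E = "\<lambda>y. (m *\<^sub>R (- (1 / ((y - 0) \<bullet> (y - 0))) *\<^sub>R (y - 0))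
      + \<eta> *\<^sub>R (- (2 * \<kappa> * ?e y) *\<^sub>R (y - x))) + 0"
  let ?J = "\<lambda>y h. (m *\<^sub>R ?JL y h + \<eta> *\<^sub>R ?JE y h) + 0"
  let ?K = "cball x (3 * s) - ball x s" and ?U = "ball x (3 * s) - cball x s"
  have near: "\<rho> / 2 \<le> norm z \<and> norm z \<le> 2 * \<rho>" if "z \<in> cball x (3 * s)" for z
  proof -
    have "norm (z - x) \<le> \<rho> / 2" using that s by (simp add: dist_norm norm_minus_commute)
    then show ?thesis using x norm_triangle_ineq2[of x z] norm_triangle_ineq2[of z x]
      by (simp add: norm_minus_commute)
  qed
  have KS: "?K \<subseteq> S" using near lower by auto
  have \<rho>: "0 < \<rho>" using s by simp
  have K0: "?K \<subseteq> - {0} \<inter> - {x}" using near[of 0] \<rho> s by auto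
  have gh: "has_grad_hess ?phi ?E ?J (- {0} \<inter> - {x})"
    by (intro has_grad_hess_add has_grad_hess_cmult has_grad_hess_const
        has_grad_hess_subset[OF has_grad_hess_log_norm] has_grad_hess_subset[OF has_grad_hess_exp_norm_sq]) auto
  have "?phi y \<le> w y"
  proof (rule comparison_principle[OF dim, where K = ?K and U = ?U and E = ?E and J = ?J])
    show "compact ?K" by (intro compact_diff) auto
    show UK: "?U \<subseteq> ?K" by auto
    show "open ?U" by auto
    show "continuous_on ?K w"
      using has_grad_hess_continuous_on[OF grad_hess] KS continuous_on_subset by blast
    show "continuous_on ?K ?phi"
      using has_grad_hess_continuous_on[OF gh] K0 continuous_on_subset by blast
    show "has_grad_hess w D H ?U"
      by (rule has_grad_hess_subset[OF grad_hess]) (use KS in auto)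
    show "has_grad_hess ?phi ?E ?J ?U"
      by (rule has_grad_hess_subset[OF gh]) (use K0 UK in blast)
    show "nlap (D z) (H z) \<le> 0" if "z \<in> ?U" "D z \<noteq> 0" for z
    proof -
      have "z \<in> S" using that KS UK by blast
      then show ?thesis using super that by blast
    qed
    show "y \<in> ?K" using y False s by auto
    show "?phi z \<le> w z" if z: "z \<in> ?K - ?U" for z
    proof -
      have "norm (z - x) = s \<or> norm (z - x) = 3 * s"
        using z by (auto simp: dist_norm norm_minus_commute)
      then show ?thesis
      proof
        assume "norm (z - x) = s"
        then have "?e z \<le> 1" "z \<in> cball x s" using \<kappa> by (auto simp: dist_norm norm_minus_commute)
        moreover have "0 \<le> \<eta> * exp (- (27 * n))" using \<eta> by simp
        moreover have "\<eta> * ?e z \<le> \<eta> * 1" using \<open>?e z \<le> 1\<close> \<eta> by (intro mult_left_mono) auto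
        moreover have "a + m * ln (1 / norm (z - 0)) + \<gamma> \<le> w z"
          using gain[OF \<open>z \<in> cball x s\<close>] by (simp add: h_def)
        ultimately show ?thesis using \<eta>(2) \<epsilon> by linarith
      next
        assume *: "norm (z - x) = 3 * s"
        then have "\<kappa> * ((z - x) \<bullet> (z - x)) = 27 * n"
          using s by (simp add: power2_norm_eq_inner[symmetric] \<kappa>_def power2_eq_square)
        moreover have "z \<in> cball x (3 * s)" using * by (simp add: dist_norm norm_minus_commute)
        ultimately show ?thesis using lower[of z] near[of z] by (simp add: h_def)
      qed
    qed
    show "?E z \<noteq> 0 \<and> 0 < nlap (?E z) (?J z)" if z: "z \<in> ?U" for z
    proof -
      have zK: "z \<in> ?K" using z UK by blast
      have nz: "\<rho> / 2 \<le> norm z" "norm z \<le> 2 * \<rho>" using near zK by auto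
      then have z0: "z \<noteq> 0" using \<rho> by auto
      have zx: "s < norm (z - x)" "norm (z - x) < 3 * s"
        using z by (auto simp: dist_norm norm_minus_commute)
      define d where "d = \<eta> *\<^sub>R (- (2 * \<kappa> * ?e z) *\<^sub>R (z - x))"
      have e: "0 < ?e z" "?e z \<le> 1" using \<kappa> by auto
      have nd: "norm d = 2 * \<eta> * \<kappa> * ?e z * norm (z - x)"
        using \<eta> \<kappa> by (simp add: d_def)
      have E: "?E z = - (m / (z \<bullet> z)) *\<^sub>R z + d" by (simp add: d_def)
      have ne: "?E z \<noteq> 0"
      proof
        assume "?E z = 0"
        then have "d = (m / (z \<bullet> z)) *\<^sub>R z" unfolding E by simp
        then have "norm d = m / norm z"
          using m by (simp add: power2_norm_eq_inner[symmetric] power2_eq_square)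
        moreover have "0 < norm d"
          unfolding nd using \<eta>(1) \<kappa> zx(1) s(1) e(1) by (intro mult_pos_pos) linarith+
        ultimately have "m \<noteq> 0" "m / norm z = norm d" by auto
        \<comment> \<open>The condition on \<open>\<eta>\<close> for m > 0 says 18 n
          \<open>\<eta>\<close> / s < m / (2 \<open>\<rho>\<close>): the gradient of the bump is
          shorter than that of the logarithm, so the two cannot cancel.\<close>
        have "norm d \<le> 2 * \<eta> * \<kappa> * 1 * (3 * s)"
          unfolding nd using e zx s \<eta> \<kappa> by (intro mult_mono) auto
        also have "\<dots> = 18 * n * \<eta> / s" using s by (simp add: \<kappa>_def power2_eq_square)
        also have "\<dots> < m / (2 * \<rho>)"
          using \<eta>(3) \<open>m \<noteq> 0\<close> s(1) \<rho> by (simp add: field_simps)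
        also have "\<dots> \<le> m / norm z" using nz z0 m \<rho> by (intro divide_left_mono) auto
        finally show False using \<open>m / norm z = norm d\<close> by simp
      qed
      have "m * nlap (?E z) (?JL z)
          = - (2 * (n - 2) * (m / (z \<bullet> z) * (1 - (?E z \<bullet> z)\<^sup>2 / ((?E z \<bullet> ?E z) * (z \<bullet> z)))))"
        using nlap_log_norm[OF ne z0] by (simp add: n_def)
      also have "\<dots> \<ge> - (2 * (n - 2) * (2 * norm d / norm z))"
        unfolding neg_le_iff_le using log_hessian_deficit[OF E ne z0 m] n by (intro mult_left_mono) auto
      finally have 1: "m * nlap (?E z) (?JL z) \<ge> - (2 * (n - 2) * (2 * norm d / norm z))" .
      have "norm (z - x) \<le> norm z" using zx nz s by simp
      \<comment> \<open>Since |z - x| <= |z|, the loss of the logarithm carries the same factor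
        \<open>\<eta> * \<kappa> * ?e z\<close> as the gain of the bump, and the two compare at
        every scale.\<close>
      then have "norm d / norm z \<le> 2 * \<eta> * \<kappa> * ?e z"
        unfolding nd using z0 \<eta> \<kappa> e by (simp add: divide_le_eq mult_left_mono)
      then have "2 * (n - 2) * (2 * norm d / norm z) \<le> 2 * (n - 2) * (2 * (2 * \<eta> * \<kappa> * ?e z))"
        using n by (intro mult_left_mono) auto
      with 1 have 2: "m * nlap (?E z) (?JL z) \<ge> - (4 * \<eta> * \<kappa> * ?e z * (2 * (n - 2)))"
        by (simp add: algebra_simps)
      have "s\<^sup>2 \<le> (z - x) \<bullet> (z - x)"
        unfolding power2_norm_eq_inner[symmetric] using zx s by (intro power_mono) auto
      then have "3 * n \<le> \<kappa> * ((z - x) \<bullet> (z - x))"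
        using n s by (simp add: \<kappa>_def field_simps)
      moreover have "0 \<le> \<kappa> * ((n - 2) * (?E z \<bullet> (z - x))\<^sup>2 / (?E z \<bullet> ?E z))" using \<kappa> n by simp
      ultimately have "3 * n - (n - 1) \<le> \<kappa> * ((z - x) \<bullet> (z - x)
          + (n - 2) * (?E z \<bullet> (z - x))\<^sup>2 / (?E z \<bullet> ?E z)) - (n - 1)"
        unfolding distrib_left by linarith
      then have "4 * \<eta> * \<kappa> * ?e z * (3 * n - (n - 1)) \<le> 4 * \<eta> * \<kappa> * ?e z * (\<kappa> * ((z - x) \<bullet> (z - x)
          + (n - 2) * (?E z \<bullet> (z - x))\<^sup>2 / (?E z \<bullet> ?E z)) - (n - 1))"
        using \<eta> \<kappa> e by (intro mult_left_mono) auto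
      also have "\<dots> = \<eta> * nlap (?E z) (?JE z)"
        unfolding nlap_id_plus_rank_one[OF ne] n_def by (simp add: power2_eq_square algebra_simps)
      finally have 3: "4 * \<eta> * \<kappa> * ?e z * (3 * n - (n - 1)) \<le> \<eta> * nlap (?E z) (?JE z)" .
      have "nlap (?E z) (?J z) = m * nlap (?E z) (?JL z) + \<eta> * nlap (?E z) (?JE z)"
        by (simp only: nlap_add nlap_cmult add_0_right)
      also have "\<dots> \<ge> 4 * \<eta> * \<kappa> * ?e z * (3 * n - (n - 1)) - 4 * \<eta> * \<kappa> * ?e z * (2 * (n - 2))"
        using 2 3 by linarith
      also have "4 * \<eta> * \<kappa> * ?e z * (3 * n - (n - 1)) - 4 * \<eta> * \<kappa> * ?e z * (2 * (n - 2))
          = 4 * \<eta> * \<kappa> * ?e z * 5" by (simp add: algebra_simps)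
      finally have "4 * \<eta> * \<kappa> * ?e z * 5 \<le> nlap (?E z) (?J z)" .
      moreover have "0 < 4 * \<eta> * \<kappa> * ?e z * 5" using \<eta> \<kappa> e by simp
      ultimately show ?thesis using ne by linarith
    qed
  qed
  moreover have "exp (- (12 * n)) \<le> ?e y"
  proof -
    have "norm (y - x) \<le> 2 * s" using y by (simp add: dist_norm norm_minus_commute)
    then have "(y - x) \<bullet> (y - x) \<le> (2 * s)\<^sup>2"
      unfolding power2_norm_eq_inner[symmetric] by (intro power_mono) auto
    then have "\<kappa> * ((y - x) \<bullet> (y - x)) \<le> \<kappa> * (2 * s)\<^sup>2" using \<kappa> by (intro mult_left_mono) auto
    also have "\<dots> = 12 * n" using s by (simp add: \<kappa>_def power2_eq_square)
    finally show ?thesis by simp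
  qed
  then have "\<eta> * exp (- (12 * n)) \<le> \<eta> * ?e y" using \<eta> by (intro mult_left_mono) auto
  ultimately show ?thesis by (simp add: h_def algebra_simps)
qed

text \<open>The points divide a great-circle arc of angle at most pi into N equal parts. Bounding
  cosine and sine separately by their Lipschitz constant 1 costs a factor 2, whence 2 pi in the
  hypothesis on N.\<close>

lemma sphere_chain:
  fixes x0 y0 :: "'a::euclidean_space"
  assumes dim: "2 \<le> DIM('a)" and \<rho>: "0 < \<rho>" "norm x0 = \<rho>" "norm y0 = \<rho>"
    and N: "0 < N" "2 * pi \<le> real N * \<theta>"
  obtains p :: "nat \<Rightarrow> 'a" where "p 0 = x0" "p N = y0" "\<And>j. norm (p j) = \<rho>"
    "\<And>j. norm (p (Suc j) - p j) \<le> \<theta> * \<rho>"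
proof -
  define c where "c = (x0 \<bullet> y0) / \<rho>\<^sup>2"
  define v where "v = y0 - c *\<^sub>R x0"
  have xx: "x0 \<bullet> x0 = \<rho>\<^sup>2" and yy: "y0 \<bullet> y0 = \<rho>\<^sup>2"
    using \<rho> by (simp_all add: power2_norm_eq_inner[symmetric])
  have xv: "x0 \<bullet> v = 0" using \<rho> xx by (simp add: v_def c_def inner_diff_right)
  have vv: "v \<bullet> v = \<rho>\<^sup>2 * (1 - c\<^sup>2)"
  proof -
    have "x0 \<bullet> y0 = c * \<rho>\<^sup>2" using \<rho> by (simp add: c_def)
    then show ?thesis
      by (simp add: v_def inner_diff_left inner_diff_right xx yy inner_commute[of y0 x0]
          power2_eq_square algebra_simps)
  qed
  have "0 \<le> \<rho>\<^sup>2 * (1 - c\<^sup>2)" using vv inner_ge_zero[of v] by simp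
  then have "c\<^sup>2 \<le> 1" using \<rho> by (simp add: zero_le_mult_iff)
  then have c1: "-1 \<le> c" "c \<le> 1" by (auto simp: abs_le_iff abs_square_le_1)
  obtain e where e: "x0 \<bullet> e = 0" "e \<bullet> e = 1" "v = norm v *\<^sub>R e"
  \<comment> \<open>For y0 equal to x0 or its antipode the plane of the arc is not determined; any
    direction orthogonal to x0 serves, and dimension at least 2 provides one.\<close>
  proof (cases "v = 0")
    case True
    obtain u0 where u0: "u0 \<noteq> 0" "x0 \<bullet> u0 = 0"
      using orthogonal_to_vector_exists[OF dim, of x0] by (auto simp: orthogonal_def)
    show thesis
      by (rule that[of "sgn u0"])
        (use u0 True in \<open>auto simp: sgn_div_norm[of u0] power2_norm_eq_inner[symmetric] power2_eq_square\<close>)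
  next
    case False
    show thesis
      by (rule that[of "sgn v"])
        (use False xv in \<open>auto simp: sgn_div_norm[of v] power2_norm_eq_inner[symmetric] power2_eq_square\<close>)
  qed
  define u where "u = \<rho> *\<^sub>R e"
  have u: "x0 \<bullet> u = 0" "u \<bullet> u = \<rho>\<^sup>2" "v = (norm v / \<rho>) *\<^sub>R u"
    using e \<rho> by (simp_all add: u_def power2_eq_square)
  define \<phi> where "\<phi> = arccos c"
  have \<phi>: "0 \<le> \<phi>" "\<phi> \<le> pi" "cos \<phi> = c"
    using c1 arccos_lbound arccos_ubound by (auto simp: \<phi>_def cos_arccos)
  have "sin \<phi> = norm v / \<rho>"
    using sin_arccos[OF c1] \<rho> by (simp add: \<phi>_def norm_eq_sqrt_inner vv real_sqrt_mult)
  then have y0: "y0 = cos \<phi> *\<^sub>R x0 + sin \<phi> *\<^sub>R u" using u(3) \<phi>(3) by (simp add: v_def algebra_simps)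
  define p where "p = (\<lambda>s. cos s *\<^sub>R x0 + sin s *\<^sub>R u)"
  have np: "norm (p s) = \<rho>" for s
  proof -
    have "p s \<bullet> p s = (cos s)\<^sup>2 * \<rho>\<^sup>2 + (sin s)\<^sup>2 * \<rho>\<^sup>2"
      by (simp add: p_def inner_add_left inner_add_right inner_commute[of u x0] u xx power2_eq_square)
    also have "\<dots> = \<rho>\<^sup>2" by (simp add: distrib_right[symmetric])
    finally show ?thesis using \<rho> by (simp add: norm_eq_sqrt_inner)
  qed
  have nu: "norm u = \<rho>" using u \<rho> by (simp add: norm_eq_sqrt_inner)
  have lip: "norm (p s - p t) \<le> 2 * \<bar>s - t\<bar> * \<rho>" for s t
  proof -
    have "\<bar>cos s - cos t\<bar> \<le> \<bar>s - t\<bar>"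
      using field_differentiable_bound[of UNIV cos "\<lambda>x. - sin x" 1 s t]
      by (auto intro!: derivative_eq_intros)
    moreover have "\<bar>sin s - sin t\<bar> \<le> \<bar>s - t\<bar>"
      using field_differentiable_bound[of UNIV sin "\<lambda>x. cos x" 1 s t]
      by (auto intro!: derivative_eq_intros)
    moreover have "p s - p t = (cos s - cos t) *\<^sub>R x0 + (sin s - sin t) *\<^sub>R u"
      by (simp add: p_def algebra_simps)
    then have "norm (p s - p t) \<le> \<bar>cos s - cos t\<bar> * \<rho> + \<bar>sin s - sin t\<bar> * \<rho>"
      using norm_triangle_ineq[of "(cos s - cos t) *\<^sub>R x0" "(sin s - sin t) *\<^sub>R u"] \<rho> nu by simp
    ultimately have "norm (p s - p t) \<le> \<bar>s - t\<bar> * \<rho> + \<bar>s - t\<bar> * \<rho>"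
      using \<rho>(1) by (smt (verit) mult_right_mono)
    then show ?thesis by (simp add: mult_ac)
  qed
  show thesis
  proof (rule that[of "\<lambda>j. p (real j * \<phi> / real N)"])
    show "p (real 0 * \<phi> / real N) = x0" by (simp add: p_def)
    show "p (real N * \<phi> / real N) = y0" using N y0 by (simp add: p_def)
    show "norm (p (real j * \<phi> / real N)) = \<rho>" for j by (rule np)
    show "norm (p (real (Suc j) * \<phi> / real N) - p (real j * \<phi> / real N)) \<le> \<theta> * \<rho>" for j
    proof -
      have "real (Suc j) * \<phi> / real N - real j * \<phi> / real N = \<phi> / real N"
        by (simp add: diff_divide_distrib[symmetric] left_diff_distrib[symmetric])
      moreover have "2 * (\<phi> / real N) \<le> \<theta>"
        using N \<phi> by (simp add: pos_divide_le_eq mult.commute)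
      then have "2 * (\<phi> / real N) * \<rho> \<le> \<theta> * \<rho>" using \<rho> by (intro mult_right_mono) auto
      ultimately show ?thesis
        using lip[of "real (Suc j) * \<phi> / real N" "real j * \<phi> / real N"] \<phi> by simp
    qed
  qed
qed

text \<open>The point is the order of quantifiers: \<open>\<epsilon>\<close> is chosen before the
  radius, the additive constant and the two points. This is possible because the number of balls
  needed to reach y0 depends only on \<open>\<theta>\<close>.\<close>

lemma (in n_superharmonic) gain_propagates:
  fixes \<theta> m \<gamma> :: real
  assumes \<theta>: "0 < \<theta>" "6 * \<theta> \<le> 1" and m: "0 \<le> m" and \<gamma>: "0 < \<gamma>"
  shows "\<exists>\<epsilon>>0. \<forall>\<rho> a x0 y0. 0 < \<rho> \<longrightarrow> norm x0 = \<rho> \<longrightarrow> norm y0 = \<rho> \<longrightarrow>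
    (\<forall>y. \<rho> / 2 \<le> norm y \<longrightarrow> norm y \<le> 2 * \<rho> \<longrightarrow> y \<in> S \<and> a + m * ln (1 / norm y) - \<epsilon> \<le> w y) \<longrightarrow>
    (\<forall>y\<in>cball x0 (\<theta> * \<rho>). a + m * ln (1 / norm y) + \<gamma> \<le> w y) \<longrightarrow>
    a + m * ln (1 / \<rho>) < w y0"
proof -
  define n where "n = real DIM('a)"
  have n: "2 \<le> n" using dim by (simp add: n_def)
  obtain N :: nat where N: "2 * pi / \<theta> < real N" using reals_Archimedean2 by blast
  have N0: "0 < N" using N \<theta> by (cases N) (auto simp: divide_less_eq intro!: Nat.gr0I)
  have N2: "2 * pi \<le> real N * \<theta>" using N \<theta> by (simp add: pos_divide_less_eq)
  define \<delta> where "\<delta> = exp (- (12 * n)) - exp (- (27 * n))"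
  have \<delta>: "0 < \<delta>" "\<delta> < 1"
  proof -
    show "0 < \<delta>" using n by (simp add: \<delta>_def)
    have "exp (- (12 * n)) \<le> 1" using n by simp
    then show "\<delta> < 1" using exp_gt_zero[of "- (27 * n)"] unfolding \<delta>_def by linarith
  qed
  \<comment> \<open>The 37 leaves room for the strict inequality with 36 in the barrier. With s =
    \<open>\<theta> * \<rho>\<close> the radius cancels from that condition.\<close>
  define c0 where "c0 = min \<gamma> (if m = 0 then 1 else m * \<theta> / (37 * n))"
  have c0: "0 < c0" "c0 \<le> \<gamma>" using \<gamma> m \<theta> n by (auto simp: c0_def)
  have c0m: "m = 0 \<or> 36 * n * c0 < m * \<theta>"
  proof (cases "m = 0")
    case False
    then have "36 * n * c0 \<le> 36 * n * (m * \<theta> / (37 * n))"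
      using n by (intro mult_left_mono) (auto simp: c0_def)
    also have "\<dots> < m * \<theta>" using n m False \<theta> by simp
    finally show ?thesis by simp
  qed simp
  \<comment> \<open>One barrier step multiplies the gain by \<open>\<delta>\<close> and loses
    \<open>c N\<close>. With ratio \<open>\<delta> / 2\<close>, half of what survives stays as gain
    and the other half covers the loss at each of the N steps.\<close>
  define c where "c = (\<lambda>j. c0 * (\<delta> / 2) ^ j)"
  have c: "0 < c j" "c j \<le> c0" for j
    using c0 \<delta> by (auto simp: c_def mult_le_cancel_left1 power_le_one)
  have c_Suc: "c (Suc j) = c j * \<delta> - c (Suc j)" for j by (simp add: c_def)
  have c_mono: "c N \<le> c j" if "j \<le> N" for j
    unfolding c_def using that \<delta> c0 by (intro mult_left_mono power_decreasing) auto
  show ?thesis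
  proof (intro exI[of _ "c N"] conjI allI impI)
    show "0 < c N" by (rule c)
    fix \<rho> a :: real and x0 y0 :: 'a
    assume \<rho>: "0 < \<rho>" "norm x0 = \<rho>" "norm y0 = \<rho>"
      and lower: "\<forall>y. \<rho> / 2 \<le> norm y \<longrightarrow> norm y \<le> 2 * \<rho> \<longrightarrow>
        y \<in> S \<and> a + m * ln (1 / norm y) - c N \<le> w y"
      and gain: "\<forall>y\<in>cball x0 (\<theta> * \<rho>). a + m * ln (1 / norm y) + \<gamma> \<le> w y"
    obtain p :: "nat \<Rightarrow> 'a" where p: "p 0 = x0" "p N = y0" "\<And>j. norm (p j) = \<rho>"
      "\<And>j. norm (p (Suc j) - p j) \<le> \<theta> * \<rho>"
      using sphere_chain[OF dim \<rho> N0 N2] by metis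
    have "\<forall>y\<in>cball (p j) (\<theta> * \<rho>). a + m * ln (1 / norm y) + c j \<le> w y" if "j \<le> N" for j
      using that
    proof (induction j)
      case 0
      show ?case
      proof
        fix y assume "y \<in> cball (p 0) (\<theta> * \<rho>)"
        then have "a + m * ln (1 / norm y) + \<gamma> \<le> w y" using gain p(1) by blast
        moreover have "c 0 \<le> \<gamma>" using c0 by (simp add: c_def)
        ultimately show "a + m * ln (1 / norm y) + c 0 \<le> w y" by linarith
      qed
    next
      case (Suc j)
      show ?case
      proof
        fix y assume y: "y \<in> cball (p (Suc j)) (\<theta> * \<rho>)"
        have "norm (y - p j) \<le> norm (y - p (Suc j)) + norm (p (Suc j) - p j)"
          using norm_triangle_ineq[of "y - p (Suc j)" "p (Suc j) - p j"] by simp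
        then have y2: "y \<in> cball (p j) (2 * (\<theta> * \<rho>))"
          using y p(4)[of j] by (simp add: dist_norm norm_minus_commute)
        have "a + m * ln (1 / norm y)
            + (c j * (exp (- (12 * real DIM('a))) - exp (- (27 * real DIM('a)))) - c N) \<le> w y"
        proof (rule barrier_step[OF _ _ p(3)[of j] m, where s = "\<theta> * \<rho>" and \<gamma> = "c j"])
          show "0 < \<theta> * \<rho>" using \<theta> \<rho> by simp
          show "6 * (\<theta> * \<rho>) \<le> \<rho>" using \<theta> \<rho> mult_right_mono[of "6 * \<theta>" 1 \<rho>] by simp
          show "m = 0 \<or> 36 * real DIM('a) * c j * \<rho> < m * (\<theta> * \<rho>)"
          proof (cases "m = 0")
            case False
            have "36 * n * c j \<le> 36 * n * c0" using c(2)[of j] n by (intro mult_left_mono) auto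
            then have "36 * n * c j < m * \<theta>" using c0m False by linarith
            then have "36 * n * c j * \<rho> < m * \<theta> * \<rho>" using \<rho> by (intro mult_strict_right_mono)
            then show ?thesis by (simp add: n_def mult.assoc)
          qed simp
        qed (use lower Suc c[of j] c(1)[of N] y2 in \<open>auto simp: less_imp_le\<close>)
        then have "a + m * ln (1 / norm y) + (c j * \<delta> - c N) \<le> w y" by (simp add: \<delta>_def n_def)
        moreover have "c N \<le> c (Suc j)" using Suc.prems by (rule c_mono)
        ultimately show "a + m * ln (1 / norm y) + c (Suc j) \<le> w y" using c_Suc[of j] by linarith
      qed
    qed
    moreover have "p N \<in> cball (p N) (\<theta> * \<rho>)" using \<theta> \<rho>(1) by simp
    ultimately have "a + m * ln (1 / norm y0) + c N \<le> w y0" using p(2) by blast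
    then show "a + m * ln (1 / \<rho>) < w y0" using c(1)[of N] \<rho> by simp
  qed
qed

section \<open>The minimum over spheres around the singularity\<close>

locale n_superharmonic_punctured = n_superharmonic w D H "ball 0 2 - {0}"
  for w :: "'a::euclidean_space \<Rightarrow> real" and D H +
  assumes nonneg: "\<And>x. x \<in> ball 0 2 - {0} \<Longrightarrow> 0 \<le> w x"
begin

definition min_profile :: "real \<Rightarrow> real" where
  "min_profile t = Inf (w ` sphere 0 (exp (- t)))"

lemma min_profile:
  assumes "0 \<le> t"
  shows "\<exists>y. norm y = exp (- t) \<and> w y = min_profile t"
    and "norm y = exp (- t) \<Longrightarrow> min_profile t \<le> w y"
proof -
  have "exp (- t) < 2" using assms by (smt (verit) exp_le_one_iff)
  then have sub: "sphere 0 (exp (- t)) \<subseteq> ball 0 2 - {0::'a}" by auto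
  have ne: "sphere (0::'a) (exp (- t)) \<noteq> {}" by simp
  have cont: "continuous_on (sphere 0 (exp (- t))) w"
    using has_grad_hess_continuous_on[OF grad_hess] sub continuous_on_subset by blast
  obtain x where x: "x \<in> sphere 0 (exp (- t))" "\<And>y. y \<in> sphere 0 (exp (- t)) \<Longrightarrow> w x \<le> w y"
    using continuous_attains_inf[OF compact_sphere ne cont] by blast
  then have "min_profile t = w x"
    unfolding min_profile_def by (intro cInf_eq_minimum) auto
  then show "\<exists>y. norm y = exp (- t) \<and> w y = min_profile t"
    "norm y = exp (- t) \<Longrightarrow> min_profile t \<le> w y"
    using x by auto
qed

lemma min_profile_le:
  assumes "x \<noteq> 0" "norm x \<le> 1"
  shows "min_profile (ln (1 / norm x)) \<le> w x"
  using min_profile(2)[of "ln (1 / norm x)" x] assms by (simp add: ln_div)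

text \<open>A three-spheres theorem: affine functions of t are logarithms of the radius, and
  comparison on the annulus is read off at a minimum point of the middle sphere. Larger t means
  smaller radius, so u gives the inner sphere.\<close>

lemma min_profile_chord:
  assumes t: "0 \<le> s" "s \<le> t" "t \<le> u"
    and ends: "a + b * s \<le> min_profile s" "a + b * u \<le> min_profile u"
  shows "a + b * t \<le> min_profile t"
proof -
  obtain y where y: "norm y = exp (- t)" "w y = min_profile t"
    using min_profile(1)[of t] t by auto
  have "exp (- s) < 2" using t by (smt (verit) exp_le_one_iff)
  then have sub: "cball 0 (exp (- s)) - ball 0 (exp (- u)) \<subseteq> ball 0 2 - {0::'a}" by auto
  have bd: "a + b * ln (1 / exp (- r)) \<le> w z"
    if "0 \<le> r" "a + b * r \<le> min_profile r" "norm (z - 0) = exp (- r)" for r z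
    using min_profile(2)[of r z] that by (simp add: ln_div)
  have "a + b * ln (1 / norm (y - 0)) \<le> w y"
    by (rule log_comparison_annulus[OF _ _ sub bd[OF _ ends(2)] bd[OF _ ends(1)]]) (use t y in auto)
  then show ?thesis using y by (simp add: ln_div)
qed

end

locale n_superharmonic_slope = n_superharmonic_punctured w D H
  for w :: "'a::euclidean_space \<Rightarrow> real" and D H +
  fixes m :: real
  assumes m_nonneg: "0 \<le> m"
    and slope_ge: "\<And>s t. 0 \<le> s \<Longrightarrow> s \<le> t \<Longrightarrow> min_profile s + m * (t - s) \<le> min_profile t"
    and slope_le: "\<And>e. 0 < e \<Longrightarrow> \<exists>T\<ge>0. \<forall>s t. T \<le> s \<longrightarrow> s \<le> t \<longrightarrow>
          min_profile t \<le> min_profile s + (m + e) * (t - s)"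
begin

text \<open>Otherwise a logarithm of weight \<open>\<sigma>\<close> centred at x carries the excess
  from B(x,r) out to a ball of radius proportional to |x|, at the price \<open>\<sigma>\<close>
  log(|x|/r). The gain then spreads over the sphere through x and contradicts the point where the
  minimum is attained.\<close>

lemma min_on_small_ball:
  assumes \<sigma>: "0 < \<sigma>"
  shows "\<exists>T. \<forall>x r. x \<noteq> 0 \<longrightarrow> T \<le> ln (1 / norm x) \<longrightarrow> 0 < r \<longrightarrow> 4 * r \<le> norm x \<longrightarrow>
    (\<exists>y\<in>cball x r. w y \<le> min_profile (ln (1 / norm x)) + (m + 2) + \<sigma> * ln (norm x / r))"
proof -
  \<comment> \<open>Between the radii \<open>\<rho>\<close> / 2 and \<open>\<theta> * \<rho>\<close>
    the logarithm of weight \<open>\<sigma>\<close> rises by at least 2m + 3, which lifts the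
    general lower bound \<open>\<mu> - m - 1\<close> to \<open>\<mu> + m + 2\<close>.\<close>
  define \<theta> where "\<theta> = min (1/6) (exp (- ((2 * m + 3) / \<sigma>)) / 2)"
  have \<theta>: "0 < \<theta>" "6 * \<theta> \<le> 1" "2 * \<theta> \<le> exp (- ((2 * m + 3) / \<sigma>))" by (auto simp: \<theta>_def)
  obtain \<epsilon> where \<epsilon>: "0 < \<epsilon>" and chain: "\<And>\<rho> a x0 y0. 0 < \<rho> \<Longrightarrow> norm x0 = \<rho> \<Longrightarrow> norm y0 = \<rho> \<Longrightarrow>
    (\<And>y. \<rho> / 2 \<le> norm y \<Longrightarrow> norm y \<le> 2 * \<rho> \<Longrightarrow>
        y \<in> ball 0 2 - {0} \<and> a + m * ln (1 / norm y) - \<epsilon> \<le> w y) \<Longrightarrow>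
    (\<And>y. y\<in>cball x0 (\<theta> * \<rho>) \<Longrightarrow> a + m * ln (1 / norm y) + 1 \<le> w y) \<Longrightarrow>
    a + m * ln (1 / \<rho>) < w y0"
    using gain_propagates[OF \<theta>(1,2) m_nonneg zero_less_one] by meson
  obtain T0 where T0: "0 \<le> T0" "\<And>s t. T0 \<le> s \<Longrightarrow> s \<le> t \<Longrightarrow>
      min_profile t \<le> min_profile s + (m + min \<epsilon> 1) * (t - s)"
    using slope_le[of "min \<epsilon> 1"] \<epsilon> by auto
  show ?thesis
  \<comment> \<open>Doubling or halving the radius moves t by ln 2 < 1, so the whole window stays
    beyond T0; the margin 2 also gives \<open>\<rho>\<close> < 1/2.\<close>
  proof (intro exI[of _ "T0 + 2"] allI impI, rule ccontr)
    fix x :: 'a and r :: real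
    assume x: "x \<noteq> 0" "T0 + 2 \<le> ln (1 / norm x)" and r: "0 < r" "4 * r \<le> norm x"
      and contra: "\<not> (\<exists>y\<in>cball x r.
        w y \<le> min_profile (ln (1 / norm x)) + (m + 2) + \<sigma> * ln (norm x / r))"
    define \<rho> where "\<rho> = norm x"
    define t where "t = ln (1 / \<rho>)"
    define \<mu> where "\<mu> = min_profile t"
    have \<rho>: "0 < \<rho>" using x by (simp add: \<rho>_def)
    have t: "T0 + 2 \<le> t" "\<rho> = exp (- t)" using x \<rho> by (simp_all add: t_def \<rho>_def ln_div)
    have "\<rho> \<le> exp (-2)" using t T0 by simp
    also have "\<dots> < 1 / 2" using exp_ge_add_one_self[of "2::real"] by (simp add: exp_minus field_simps)
    finally have \<rho>_half: "\<rho> < 1 / 2" .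
    have big: "\<mu> + (m + 2) + \<sigma> * ln (\<rho> / r) < w y" if "y \<in> cball x r" for y
      using contra that by (force simp: \<mu>_def t_def \<rho>_def)
    have ln2: "ln 2 \<le> (1::real)" using ln_2_less_1 by simp
    have ln_near: "\<bar>ln (1 / norm y) - t\<bar> \<le> 1" if y: "\<rho> / 2 \<le> norm y" "norm y \<le> 2 * \<rho>" for y :: 'a
    proof -
      have ny: "0 < norm y" using y \<rho> by linarith
      have "ln (\<rho> / 2) \<le> ln (norm y)" "ln (norm y) \<le> ln (2 * \<rho>)"
        by (rule iffD2[OF ln_le_cancel_iff]; use y \<rho> ny in linarith)+
      then show ?thesis using ln2 \<rho> ny by (simp add: ln_div ln_mult t_def abs_le_iff)
    qed
    \<comment> \<open>The line of slope m through (t, \<open>\<mu>\<close>) lies below the profile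
      for larger t, and exceeds it by at most the slope error for smaller t in the unit window. The
      minimum with 1 fixes the constant in the crude bound below.\<close>
    have lower: "y \<in> ball 0 2 - {0} \<and> \<mu> - m * t + m * ln (1 / norm y) - min \<epsilon> 1 \<le> w y"
      if y: "\<rho> / 2 \<le> norm y" "norm y \<le> 2 * \<rho>" for y
    proof -
      define s where "s = ln (1 / norm y)"
      have s: "\<bar>s - t\<bar> \<le> 1" using ln_near[OF y] by (simp add: s_def)
      have yn: "y \<noteq> 0" "norm y \<le> 1" using y \<rho> \<rho>_half by auto
      have "\<mu> + m * (s - t) - min \<epsilon> 1 \<le> min_profile s"
      proof (cases "t \<le> s")
        case True
        then show ?thesis using slope_ge[of t s] t T0 \<epsilon> by (simp add: \<mu>_def)
      next
        case False
        then have "min_profile t \<le> min_profile s + (m + min \<epsilon> 1) * (t - s)"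
          using T0(2)[of s t] s t by simp
        moreover have "min \<epsilon> 1 * (t - s) \<le> min \<epsilon> 1" using s \<epsilon> False by (intro mult_left_le) auto
        moreover have "m * (s - t) = - (m * (t - s))" by (simp add: algebra_simps)
        ultimately show ?thesis unfolding \<mu>_def distrib_right by linarith
      qed
      also have "\<dots> \<le> w y" using min_profile_le[OF yn] by (simp add: s_def)
      finally show ?thesis using yn by (simp add: s_def algebra_simps)
    qed
    have near_norm: "\<rho> / 2 \<le> norm y \<and> norm y \<le> 2 * \<rho>" if "y \<in> cball x (\<rho> / 2)" for y
    proof -
      have "norm (y - x) \<le> \<rho> / 2" using that by (simp add: dist_norm norm_minus_commute)
      then show ?thesis using norm_triangle_ineq2[of x y] norm_triangle_ineq2[of y x]
        by (simp add: \<rho>_def norm_minus_commute)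
    qed
    have mln: "m * \<bar>ln (1 / norm y) - t\<bar> \<le> m" if "y \<in> cball x (\<rho> / 2)" for y
      using ln_near near_norm[OF that] m_nonneg by (intro mult_left_le) auto
    have lower_ball: "\<mu> - m - 1 \<le> w y" if y: "y \<in> cball x (\<rho> / 2)" for y
    proof -
      have "- (m * \<bar>ln (1 / norm y) - t\<bar>) \<le> m * (ln (1 / norm y) - t)"
        using mult_left_mono[of "- \<bar>ln (1 / norm y) - t\<bar>" "ln (1 / norm y) - t" m] m_nonneg by simp
      then have "\<mu> - m - 1 \<le> \<mu> - m * t + m * ln (1 / norm y) - min \<epsilon> 1"
        using mln[OF y] by (simp add: right_diff_distrib)
      then show ?thesis using lower near_norm[OF y] by fastforce
    qed
    \<comment> \<open>Normalised so that the barrier equals the crude bound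
      \<open>\<mu> - m - 1\<close> at distance \<open>\<rho>\<close> / 2 from x.\<close>
    define a where "a = \<mu> - m - 1 - \<sigma> * ln (1 / (\<rho> / 2))"
    have log_lower: "a + \<sigma> * ln (1 / norm (y - x)) \<le> w y"
      if y: "r \<le> norm (y - x)" "norm (y - x) \<le> \<rho> / 2" for y
    proof (rule log_comparison_annulus[OF r(1), of "\<rho> / 2" x])
      show "r \<le> \<rho> / 2" using r by (simp add: \<rho>_def)
      show "cball x (\<rho> / 2) - ball x r \<subseteq> ball 0 2 - {0}" using near_norm lower by blast
      show "a + \<sigma> * ln (1 / r) \<le> w z" if z: "norm (z - x) = r" for z
      proof -
        have "z \<in> cball x r" using z by (simp add: dist_norm norm_minus_commute)
        have "ln (1 / r) - ln (1 / (\<rho> / 2)) \<le> ln (\<rho> / r)"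
          using r \<rho> by (simp add: ln_div)
        then have "\<sigma> * (ln (1 / r) - ln (1 / (\<rho> / 2))) \<le> \<sigma> * ln (\<rho> / r)"
          using \<sigma> by (intro mult_left_mono) auto
        then show ?thesis using big[OF \<open>z \<in> cball x r\<close>] m_nonneg
          unfolding a_def right_diff_distrib by linarith
      qed
      show "a + \<sigma> * ln (1 / (\<rho> / 2)) \<le> w z" if "norm (z - x) = \<rho> / 2" for z
        using lower_ball[of z] that by (simp add: a_def dist_norm norm_minus_commute)
    qed (use y in auto)
    have gain: "\<mu> - m * t + m * ln (1 / norm y) + 1 \<le> w y" if y: "y \<in> cball x (\<theta> * \<rho>)" for y
    proof -
      have nyx: "norm (y - x) \<le> \<theta> * \<rho>" using y by (simp add: dist_norm norm_minus_commute)
      also have "\<theta> * \<rho> \<le> \<rho> / 2" using mult_right_mono[of \<theta> "1/2" \<rho>] \<theta> \<rho> by simp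
      finally have y2: "y \<in> cball x (\<rho> / 2)" by (simp add: dist_norm norm_minus_commute)
      have "\<mu> + m + 2 \<le> w y"
      proof (cases "norm (y - x) \<le> r")
        case True
        have "0 \<le> \<sigma> * ln (\<rho> / r)" using \<sigma> r by (simp add: \<rho>_def)
        then show ?thesis using big[of y] True by (simp add: dist_norm norm_minus_commute)
      next
        case False
        then have pos: "0 < norm (y - x)" using r by linarith
        have "norm (y - x) / (\<rho> / 2) \<le> 2 * \<theta>" using nyx \<rho> by (simp add: field_simps)
        also have "\<dots> \<le> exp (- ((2 * m + 3) / \<sigma>))" by (rule \<theta>)
        finally have "ln (norm (y - x) / (\<rho> / 2)) \<le> - ((2 * m + 3) / \<sigma>)"
          using pos \<rho> by (metis divide_pos_pos half_gt_zero ln_exp ln_le_cancel_iff exp_gt_zero)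
        then have "(2 * m + 3) / \<sigma> \<le> ln (1 / norm (y - x)) - ln (1 / (\<rho> / 2))"
          using pos \<rho> by (simp add: ln_div ln_mult)
        then have "\<sigma> * ((2 * m + 3) / \<sigma>) \<le> \<sigma> * (ln (1 / norm (y - x)) - ln (1 / (\<rho> / 2)))"
          using \<sigma> by (intro mult_left_mono) auto
        then have "2 * m + 3 \<le> \<sigma> * ln (1 / norm (y - x)) - \<sigma> * ln (1 / (\<rho> / 2))"
          using \<sigma> by (simp add: right_diff_distrib)
        moreover have "a + \<sigma> * ln (1 / norm (y - x)) \<le> w y"
          using log_lower[of y] False y2 by (simp add: dist_norm norm_minus_commute)
        ultimately show ?thesis unfolding a_def by linarith
      qed
      moreover have "m * (ln (1 / norm y) - t) \<le> m * \<bar>ln (1 / norm y) - t\<bar>"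
        using m_nonneg by (intro mult_left_mono) auto
      ultimately show ?thesis using mln[OF y2] by (simp add: right_diff_distrib)
    qed
    obtain y0 where y0: "norm y0 = \<rho>" "w y0 = \<mu>"
      using min_profile(1)[of t] t T0 by (auto simp: \<mu>_def)
    have "\<mu> - m * t + m * ln (1 / \<rho>) < w y0"
    proof (rule chain[OF \<rho> _ y0(1) _ gain])
      show "norm x = \<rho>" by (simp add: \<rho>_def)
      fix y :: 'a assume "\<rho> / 2 \<le> norm y" "norm y \<le> 2 * \<rho>"
      from lower[OF this]
      show "y \<in> ball 0 2 - {0} \<and> \<mu> - m * t + m * ln (1 / norm y) - \<epsilon> \<le> w y" by auto
    qed
    then show False using y0 by (simp add: t_def)
  qed
qed

end

text \<open>The function w(c + r y) / L has oscillation at most 2 on the unit ball, and its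
  normalised Laplacian is at least -C (r e^w)^2 / L >= -4C/L >= -1.\<close>

lemma rescaled_holder_estimate:
  fixes w :: "'a::euclidean_space \<Rightarrow> real"
  assumes dim: "2 \<le> DIM('a)" and gh: "has_grad_hess w D H S" and S: "cball c r \<subseteq> S"
    and eqn: "\<And>x. x \<in> S \<Longrightarrow> D x \<noteq> 0 \<Longrightarrow>
       - (C * exp (2 * w x)) \<le> nlap (D x) (H x) \<and> nlap (D x) (H x) \<le> 0"
    and r: "0 < r" and L: "0 < L" "4 * C \<le> L" and C: "0 \<le> C"
    and bd: "\<And>x. x \<in> cball c r \<Longrightarrow> 0 \<le> w x \<and> w x \<le> 2 * L \<and> r * exp (w x) \<le> 2"
    and y: "y \<in> cball c r"
  shows "w c - w y \<le> 600 * real DIM('a) * sqrt (norm (y - c) / r) * L"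
proof -
  let ?S = "{y. c + r *\<^sub>R y \<in> S}"
  let ?v = "\<lambda>y. (1 / L) * w (c + r *\<^sub>R y)"
  let ?D = "\<lambda>y. (1 / L * r) *\<^sub>R D (c + r *\<^sub>R y)"
  let ?H = "\<lambda>y h. (1 / L * r\<^sup>2) *\<^sub>R H (c + r *\<^sub>R y) h"
  have in_cball: "c + r *\<^sub>R y \<in> cball c r" if "y \<in> cball 0 1" for y
    using that r by (simp add: dist_norm)
  define z where "z = (1 / r) *\<^sub>R (y - c)"
  have z: "z \<in> cball 0 1" "c + r *\<^sub>R z = y" "norm z = norm (y - c) / r"
    using y r by (auto simp: z_def dist_norm norm_minus_commute)
  have "?v 0 - ?v z \<le> 600 * real DIM('a) * sqrt (norm z)"
  proof (rule sqrt_norm_holder_estimate[OF dim has_grad_hess_affine[OF gh]])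
    show "cball 0 1 \<subseteq> ?S" using in_cball S by blast
    show "z \<in> cball 0 1" by (rule z)
    show "?v x - ?v y \<le> 2" if xy: "x \<in> cball 0 1" "y \<in> cball 0 1" for x y
    proof -
      have "w (c + r *\<^sub>R x) - w (c + r *\<^sub>R y) \<le> 2 * L"
        using bd[OF in_cball[OF xy(1)]] bd[OF in_cball[OF xy(2)]] by linarith
      then show ?thesis using L by (simp add: diff_divide_distrib[symmetric] divide_le_eq)
    qed
    fix x :: 'a assume x: "x \<in> ball 0 1" and D0: "?D x \<noteq> 0"
    define u where "u = c + r *\<^sub>R x"
    have u: "u \<in> cball c r" using in_cball[of x] x by (auto simp: u_def)
    then have uS: "u \<in> S" using S by blast
    have Du: "D u \<noteq> 0" using D0 by (auto simp: u_def)
    have "nlap (?D x) (?H x) = 1 / L * r\<^sup>2 * nlap (D u) (H u)"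
    proof -
      have "nlap (?D x) (?H x) = 1 / L * r\<^sup>2 * nlap (?D x) (H u)"
        unfolding u_def by (rule nlap_cmult)
      also have "nlap (?D x) (H u) = nlap (D u) (H u)"
        unfolding u_def[symmetric] using L r
        by (intro nlap_scale_left has_grad_hess_linear[OF gh uS]) auto
      finally show ?thesis .
    qed
    moreover have "1 / L * r\<^sup>2 * nlap (D u) (H u) \<le> 0"
      using eqn[OF uS Du] L by (intro mult_nonneg_nonpos) auto
    moreover have "- 1 \<le> 1 / L * r\<^sup>2 * nlap (D u) (H u)"
    proof -
      have "(r * exp (w u))\<^sup>2 \<le> 2\<^sup>2" using bd[OF u] r by (intro power_mono) auto
      then have "C * (r * exp (w u))\<^sup>2 \<le> C * 4" using C by (intro mult_left_mono) auto
      also have "\<dots> \<le> L" using L by simp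
      finally have "r\<^sup>2 * (C * exp (2 * w u)) \<le> L"
        by (simp add: power_mult_distrib exp_double[symmetric] mult_ac)
      moreover have "r\<^sup>2 * - (C * exp (2 * w u)) \<le> r\<^sup>2 * nlap (D u) (H u)"
        using eqn[OF uS Du] by (intro mult_left_mono) auto
      ultimately have "- L \<le> r\<^sup>2 * nlap (D u) (H u)" by simp
      then show ?thesis using L by (simp add: field_simps)
    qed
    ultimately show "-1 \<le> nlap (?D x) (?H x) \<and> nlap (?D x) (?H x) \<le> 0" by simp
  qed
  then have "(w c - w y) / L \<le> 600 * real DIM('a) * sqrt (norm (y - c) / r)"
    unfolding z(2) z(3) by (simp add: diff_divide_distrib)
  then show ?thesis using L by (simp add: pos_divide_le_eq)
qed

section \<open>The upper bound\<close>

context n_superharmonic_slope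
begin

text \<open>Before the threshold T of \<open>slope_le\<close> the profile is nondecreasing, since m
  >= 0, so its value at T serves as K.\<close>

lemma min_profile_affine_bound:
  assumes "0 < e"
  shows "\<exists>K. \<forall>t\<ge>0. min_profile t \<le> (m + e) * t + K"
proof -
  obtain T where T: "0 \<le> T" "\<And>t. T \<le> t \<Longrightarrow> min_profile t \<le> min_profile T + (m + e) * (t - T)"
    using slope_le[OF assms] by blast
  have "min_profile t \<le> (m + e) * t + min_profile T" if "0 \<le> t" for t
  proof (cases "T \<le> t")
    case True
    have "(m + e) * (t - T) \<le> (m + e) * t" using T(1) assms m_nonneg by (intro mult_left_mono) auto
    then show ?thesis using T(2)[OF True] by linarith
  next
    case False
    then have "min_profile t + m * (T - t) \<le> min_profile T" using slope_ge that by simp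
    moreover have "0 \<le> m * (T - t)" "0 \<le> (m + e) * t" using False m_nonneg that assms by auto
    ultimately show ?thesis by linarith
  qed
  then show ?thesis by blast
qed

text \<open>If the maximum of F is at least 2, the estimate is made at its maximum point z on the
  scale e^(-w(z)), and w(x) <= w(z). Otherwise w is already at most log(1/|x|) + O(1) on a ball of
  radius |x|/4, and the estimate is made at x itself.\<close>

lemma upper_bound:
  fixes \<epsilon> C :: real
  assumes C: "0 \<le> C"
    and eqn: "\<And>x. x \<in> ball 0 2 - {0} \<Longrightarrow> D x \<noteq> 0 \<Longrightarrow> - (C * exp (2 * w x)) \<le> nlap (D x) (H x)"
    and \<epsilon>: "0 < \<epsilon>"
  shows "\<exists>T. \<forall>x. x \<noteq> 0 \<longrightarrow> T \<le> ln (1 / norm x) \<longrightarrow> w x \<le> (m + \<epsilon>) * ln (1 / norm x)"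
proof -
  define P where "P = 600 * real DIM('a)"
  have P: "1 \<le> P" using dim by (simp add: P_def)
  \<comment> \<open>Chosen so that
    \<open>m + e + \<epsilon> / 2 \<le> (1 - 2 * e) * (m + \<epsilon>)\<close>, which is
    \<open>e_gap\<close> rearranged.\<close>
  define e where "e = \<epsilon> / (4 * (m + \<epsilon> + 1))"
  have e: "0 < e" using \<epsilon> m_nonneg by (simp add: e_def)
  have e_gap: "e * (2 * (m + \<epsilon>) + 1) \<le> \<epsilon> / 2"
  proof -
    have "e * (2 * (m + \<epsilon>) + 1) \<le> e * (2 * (m + \<epsilon> + 1))" using e by (intro mult_left_mono) auto
    also have "\<dots> = \<epsilon> / 2" using \<epsilon> m_nonneg by (simp add: e_def field_simps)
    finally show ?thesis .
  qed
  have e_lt: "4 * e < 1" using \<epsilon> m_nonneg by (simp add: e_def field_simps)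
  \<comment> \<open>On the fraction \<open>\<theta>\<close> of a ball the square-root modulus of
    continuity has size exactly e.\<close>
  define \<theta> where "\<theta> = (e / P)\<^sup>2"
  have \<theta>: "0 < \<theta>" "P * sqrt \<theta> = e" using e P by (simp_all add: \<theta>_def)
  have \<theta>1: "\<theta> \<le> 1 / 16"
  proof -
    have "e / P \<le> 1 / 4" using e e_lt P by (simp add: divide_le_eq)
    then have "(e / P)\<^sup>2 \<le> (1 / 4)\<^sup>2" using e P by (intro power_mono) auto
    then show ?thesis by (simp add: \<theta>_def power2_eq_square)
  qed
  obtain K where K: "\<And>t. 0 \<le> t \<Longrightarrow> min_profile t \<le> (m + e) * t + K"
    using min_profile_affine_bound[OF e] by blast
  obtain T1 where T1: "\<And>x r. x \<noteq> 0 \<Longrightarrow> T1 \<le> ln (1 / norm x) \<Longrightarrow> 0 < r \<Longrightarrow> 4 * r \<le> norm x \<Longrightarrow>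
    \<exists>y\<in>cball x r. w y \<le> min_profile (ln (1 / norm x)) + (m + 2) + e * ln (norm x / r)"
    using min_on_small_ball[OF e] by meson
  \<comment> \<open>Bounded terms of both cases: m + e from replacing log(1/|z|) by t + 1, 3e from
    the normalisation L = t + 3, and ln(4/\<open>\<theta>\<close>) from the radius |x|/4. In T, the
    summand 1 after T1 allows for the shift from x to z, and \<open>4 * C\<close> makes every L >= t
    admissible.\<close>
  define Q where "Q = (m + e) + K + (m + 2) + e * ln (4 / \<theta>) + 3 * e"
  define T where "T = Max {T1 + 1, 4 * C, 2, 2 * Q / \<epsilon>}"
  have T: "T1 + 1 \<le> T" "4 * C \<le> T" "2 \<le> T" "2 * Q / \<epsilon> \<le> T" by (auto simp: T_def)
  have holder: "w c - w y \<le> e * L"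
    if sub: "cball c r \<subseteq> ball 0 2 - {0}" and r: "0 < r" and L: "0 < L" "4 * C \<le> L"
      and bd: "\<And>x. x \<in> cball c r \<Longrightarrow> w x \<le> 2 * L \<and> r * exp (w x) \<le> 2"
      and y: "y \<in> cball c (\<theta> * r)" for c y r L
  proof -
    have y': "norm (y - c) \<le> \<theta> * r" using y by (simp add: dist_norm norm_minus_commute)
    then have "norm (y - c) \<le> 1 * r" using mult_right_mono[of \<theta> 1 r] \<theta>1 r by linarith
    then have yr: "y \<in> cball c r" by (simp add: dist_norm norm_minus_commute)
    have "w c - w y \<le> P * sqrt (norm (y - c) / r) * L"
      unfolding P_def
    proof (rule rescaled_holder_estimate[OF dim grad_hess sub _ r L C _ yr])
      show "- (C * exp (2 * w x)) \<le> nlap (D x) (H x) \<and> nlap (D x) (H x) \<le> 0"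
        if "x \<in> ball 0 2 - {0}" "D x \<noteq> 0" for x
        using eqn super that by blast
      show "0 \<le> w x \<and> w x \<le> 2 * L \<and> r * exp (w x) \<le> 2" if "x \<in> cball c r" for x
        using nonneg[of x] bd[OF that] that sub by blast
    qed
    also have "\<dots> \<le> P * sqrt \<theta> * L"
      using y' r P L by (intro mult_right_mono mult_left_mono) (auto simp: divide_le_eq)
    finally show ?thesis using \<theta> by simp
  qed
  have near_min: "\<exists>y\<in>cball x (\<theta> * r). w y \<le> (m + e) * ln (1 / norm x) + K + (m + 2)
       + e * (ln (1 / \<theta>) + ln (norm x / r))"
    if x: "x \<noteq> 0" "T1 \<le> ln (1 / norm x)" "0 \<le> ln (1 / norm x)" and r: "0 < r" "r \<le> norm x" for x r
  proof -
    have "\<theta> * r \<le> 1 / 16 * r" using \<theta>1 r by (intro mult_right_mono) auto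
    then have "4 * (\<theta> * r) \<le> norm x" using r by linarith
    then obtain y where y: "y \<in> cball x (\<theta> * r)"
      "w y \<le> min_profile (ln (1 / norm x)) + (m + 2) + e * ln (norm x / (\<theta> * r))"
      using T1[of x "\<theta> * r"] x \<theta> r by auto
    moreover have "ln (norm x / (\<theta> * r)) = ln (1 / \<theta>) + ln (norm x / r)"
      using x r \<theta> by (simp add: ln_div ln_mult)
    ultimately show ?thesis using K[OF x(3)] by (intro bexI[of _ y]) auto
  qed
  show ?thesis
  proof (intro exI[of _ T] allI impI)
    fix x :: 'a assume x: "x \<noteq> 0" "T \<le> ln (1 / norm x)"
    define \<rho> where "\<rho> = norm x"
    define t where "t = ln (1 / \<rho>)"
    have \<rho>: "0 < \<rho>" using x by (simp add: \<rho>_def)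
    have t: "T \<le> t" "\<rho> = exp (- t)" using x \<rho> by (simp_all add: t_def \<rho>_def ln_div)
    have "\<rho> \<le> exp (-2)" using t T by simp
    also have "\<dots> < 1 / 2" using exp_ge_add_one_self[of "2::real"] by (simp add: exp_minus field_simps)
    finally have \<rho>_half: "\<rho> < 1 / 2" .
    have near_norm: "\<rho> / 2 \<le> norm y \<and> norm y \<le> 2 * \<rho>" if "y \<in> cball x (\<rho> / 2)" for y
    proof -
      have "norm (y - x) \<le> \<rho> / 2" using that by (simp add: dist_norm norm_minus_commute)
      then show ?thesis using norm_triangle_ineq2[of x y] norm_triangle_ineq2[of y x]
        by (simp add: \<rho>_def norm_minus_commute)
    qed
    have sub: "cball x (\<rho> / 2) \<subseteq> ball 0 2 - {0}"
    proof
      fix y assume "y \<in> cball x (\<rho> / 2)"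
      then have "\<rho> / 2 \<le> norm y" "norm y \<le> 2 * \<rho>" using near_norm by auto
      then show "y \<in> ball 0 2 - {0}" using \<rho> \<rho>_half by auto
    qed
    have "2 * Q / \<epsilon> \<le> t" using T(4) t(1) by simp
    then have QT: "Q \<le> \<epsilon> / 2 * t" using \<epsilon> by (simp add: divide_le_eq mult.commute)
    \<comment> \<open>At its maximum point $z$ this yields $e^{w(y)} \le 2e^{w(z)}$ for $|y-z| \le d/2$.\<close>
    define F where "F = (\<lambda>y. exp (w y) * (\<rho> / 2 - norm (y - x)))"
    have "continuous_on (cball x (\<rho> / 2)) F"
      unfolding F_def
      by (intro continuous_intros continuous_on_subset[OF has_grad_hess_continuous_on[OF grad_hess] sub])
    moreover have "cball x (\<rho> / 2) \<noteq> {}" using \<rho> by simp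
    ultimately obtain z where z: "z \<in> cball x (\<rho> / 2)" "\<And>y. y \<in> cball x (\<rho> / 2) \<Longrightarrow> F y \<le> F z"
      using continuous_attains_sup[OF compact_cball] by metis
    define d where "d = \<rho> / 2 - norm (z - x)"
    have Fz: "F z = exp (w z) * d" by (simp add: F_def d_def)
    have Fx: "exp (w x) * (\<rho> / 2) \<le> exp (w z) * d"
      using z(2)[of x] \<rho> unfolding Fz by (simp add: F_def)
    moreover have "0 < exp (w x) * (\<rho> / 2)" using \<rho> by simp
    ultimately have "0 < exp (w z) * d" by linarith
    then have d: "0 < d" "d \<le> \<rho> / 2" by (simp_all add: zero_less_mult_iff d_def)
    have goal: "w x \<le> (m + \<epsilon>) * t"
    proof (cases "2 \<le> exp (w z) * d")
      case True
      have z0: "z \<noteq> 0" "\<rho> / 2 \<le> norm z" "norm z \<le> 2 * \<rho>" using near_norm[OF z(1)] \<rho> by auto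
      define r where "r = exp (- w z)"
      have r: "0 < r" "r \<le> d / 2" using True by (simp_all add: r_def exp_minus field_simps)
      have rsub: "cball z r \<subseteq> cball x (\<rho> / 2)" and
        rdist: "\<And>y. y \<in> cball z r \<Longrightarrow> d / 2 \<le> \<rho> / 2 - norm (y - x)"
      proof -
        show rdist: "d / 2 \<le> \<rho> / 2 - norm (y - x)" if "y \<in> cball z r" for y
        proof -
          have "norm (y - x) \<le> norm (y - z) + norm (z - x)"
            using norm_triangle_ineq[of "y - z" "z - x"] by simp
          moreover have "norm (y - z) \<le> d / 2"
            using that r by (simp add: dist_norm norm_minus_commute)
          ultimately show ?thesis by (simp add: d_def)
        qed
        show "cball z r \<subseteq> cball x (\<rho> / 2)"
        proof
          fix y assume "y \<in> cball z r"
          then have "norm (y - x) \<le> \<rho> / 2" using rdist d by fastforce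
          then show "y \<in> cball x (\<rho> / 2)" by (simp add: dist_norm norm_minus_commute)
        qed
      qed
      \<comment> \<open>This makes L = w z admissible in the rescaled estimate: it is at least 4C,
        and w <= w z + ln 2 <= 2 w z on the ball.\<close>
      have wz: "t \<le> w z"
      proof -
        have "exp (w z) * d \<le> exp (w z) * (\<rho> / 2)" using d by (intro mult_left_mono) auto
        then have "1 \<le> exp (w z) * \<rho>" using True by linarith
        then have "1 / \<rho> \<le> exp (w z)" using \<rho> by (simp add: divide_le_eq)
        then have "ln (1 / \<rho>) \<le> ln (exp (w z))" using \<rho> by (subst ln_le_cancel_iff) auto
        then show ?thesis by (simp add: t_def)
      qed
      have exp_le: "exp (w y) \<le> 2 * exp (w z)" if "y \<in> cball z r" for y
      proof -
        have "exp (w y) * (d / 2) \<le> F y" unfolding F_def using rdist[OF that] by (intro mult_left_mono) auto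
        also have "\<dots> \<le> exp (w z) * d" using z(2)[of y] rsub that Fz by auto
        finally show ?thesis using d by simp
      qed
      have bd: "w y \<le> 2 * w z \<and> r * exp (w y) \<le> 2" if "y \<in> cball z r" for y
      proof
        have "ln (exp (w y)) \<le> ln (2 * exp (w z))" using exp_le[OF that] by (subst ln_le_cancel_iff) auto
        then have "w y \<le> ln 2 + w z" by (simp add: ln_mult)
        then show "w y \<le> 2 * w z" using ln_2_less_1 wz t T by linarith
        have "r * exp (w y) \<le> r * (2 * exp (w z))" using exp_le[OF that] r by (intro mult_left_mono) auto
        also have "\<dots> = 2" by (simp add: r_def exp_minus)
        finally show "r * exp (w y) \<le> 2" .
      qed
      have lnz: "t - 1 \<le> ln (1 / norm z)" "ln (1 / norm z) \<le> t + 1"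
      proof -
        have "0 < norm z" using z0 by simp
        have "ln (\<rho> / 2) \<le> ln (norm z)" "ln (norm z) \<le> ln (2 * \<rho>)"
          by (rule iffD2[OF ln_le_cancel_iff]; use z0 \<rho> \<open>0 < norm z\<close> in linarith)+
        then show "t - 1 \<le> ln (1 / norm z)" "ln (1 / norm z) \<le> t + 1"
          using ln_2_less_1 \<rho> \<open>0 < norm z\<close> by (simp_all add: t_def ln_div ln_mult)
      qed
      obtain y where y: "y \<in> cball z (\<theta> * r)" "w y \<le> (m + e) * ln (1 / norm z) + K + (m + 2)
          + e * (ln (1 / \<theta>) + ln (norm z / r))"
      proof -
        have "T1 \<le> ln (1 / norm z)" "0 \<le> ln (1 / norm z)" "r \<le> norm z"
          using z0 lnz T t r d by linarith+
        with near_min[OF z0(1) _ _ r(1)] that show thesis by blast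
      qed
      have "w z - w y \<le> e * w z"
        by (rule holder[OF _ r(1) _ _ bd y(1)]) (use rsub sub wz T t in auto)
      \<comment> \<open>As r = e^(-w z), the logarithmic loss is at most e times w z plus a
        constant. It is absorbed on the left together with the error from the modulus of continuity,
        giving the factor 1 - 2e.\<close>
      moreover have "e * (ln (1 / \<theta>) + ln (norm z / r)) \<le> e * (ln (4 / \<theta>) + w z)"
      proof (intro mult_left_mono add_mono)
        show "ln (1 / \<theta>) \<le> ln (4 / \<theta>)" using \<theta> by (subst ln_le_cancel_iff) (auto simp: divide_right_mono)
        have "ln (norm z / r) = - ln (1 / norm z) + w z" using z0 r by (simp add: ln_div r_def)
        then show "ln (norm z / r) \<le> w z" using lnz t T by linarith
      qed (use e in auto)
      moreover have "(m + e) * ln (1 / norm z) \<le> (m + e) * (t + 1)"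
        using lnz m_nonneg e by (intro mult_left_mono) auto
      ultimately have "(1 - 2 * e) * w z \<le> (m + e) * t + Q"
        using y(2) e by (simp add: Q_def algebra_simps)
      also have "\<dots> \<le> (m + e) * t + \<epsilon> / 2 * t" using QT by simp
      also have "\<dots> = (m + e + \<epsilon> / 2) * t" by (simp add: algebra_simps)
      also have "\<dots> \<le> (1 - 2 * e) * (m + \<epsilon>) * t"
        using e_gap t T by (intro mult_right_mono) (auto simp: algebra_simps)
      finally have "(1 - 2 * e) * w z \<le> (1 - 2 * e) * ((m + \<epsilon>) * t)" by (simp add: mult.assoc)
      then have "w z \<le> (m + \<epsilon>) * t" using e_lt e by simp
      moreover have "w x \<le> w z"
      proof -
        have "exp (w x) * (\<rho> / 2) \<le> exp (w z) * (\<rho> / 2)"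
          by (intro order_trans[OF Fx] mult_left_mono d(2)) simp
        then show ?thesis using \<rho> by simp
      qed
      ultimately show ?thesis by simp
    next
      case False
      \<comment> \<open>On this ball the weight in F is at least \<open>\<rho>\<close> / 4, so F < 2
        gives e^w <= 8 / \<open>\<rho>\<close>, that is w <= t + ln 8 < t + 3. Hence L = t +
        3.\<close>
      define r where "r = \<rho> / 4"
      have r: "0 < r" "r \<le> norm x" using \<rho> by (auto simp: r_def \<rho>_def)
      have rsub: "cball x r \<subseteq> cball x (\<rho> / 2)" using \<rho> by (intro subset_cball) (simp add: r_def)
      have rexp: "r * exp (w y) \<le> 2" if "y \<in> cball x r" for y
      proof -
        have "r \<le> \<rho> / 2 - norm (y - x)" using that by (simp add: r_def dist_norm norm_minus_commute)
        then have "exp (w y) * r \<le> F y" unfolding F_def by (intro mult_left_mono) auto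
        also have "\<dots> \<le> 2" using z(2)[of y] rsub that Fz False by fastforce
        finally show ?thesis by (simp add: mult.commute)
      qed
      have bd: "w y \<le> 2 * (t + 3) \<and> r * exp (w y) \<le> 2" if "y \<in> cball x r" for y
      proof
        have "exp (w y) \<le> 2 / r" using rexp[OF that] r by (simp add: le_divide_eq mult.commute)
        then have "ln (exp (w y)) \<le> ln (2 / r)" using r by (subst ln_le_cancel_iff) auto
        also have "\<dots> = ln 8 + t" using \<rho> by (simp add: r_def t_def ln_div)
        also have "ln 8 = 3 * ln (2::real)" using ln_realpow[of 2 3] by simp
        finally show "w y \<le> 2 * (t + 3)" using ln_2_less_1 t T by simp
      qed (use rexp that in auto)
      obtain y where y: "y \<in> cball x (\<theta> * r)" "w y \<le> (m + e) * t + K + (m + 2)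
          + e * (ln (1 / \<theta>) + ln (norm x / r))"
      proof -
        have "T1 \<le> ln (1 / norm x)" "0 \<le> ln (1 / norm x)"
          using x(2) T by linarith+
        with near_min[OF x(1) _ _ r] that show thesis unfolding t_def \<rho>_def by blast
      qed
      have "w x - w y \<le> e * (t + 3)"
        by (rule holder[OF _ r(1) _ _ bd y(1)]) (use rsub sub T t in auto)
      moreover have "ln (1 / \<theta>) + ln (norm x / r) = ln (4 / \<theta>)"
        using \<theta> \<rho> by (simp add: r_def \<rho>_def[symmetric] ln_div)
      ultimately have "w x \<le> (m + e) * t + e * t + Q"
        using y(2) m_nonneg e by (simp add: Q_def algebra_simps)
      also have "\<dots> \<le> (m + e) * t + e * t + \<epsilon> / 2 * t" using QT by simp
      also have "\<dots> = (m + 2 * e + \<epsilon> / 2) * t" by (simp add: algebra_simps)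
      also have "\<dots> \<le> (m + \<epsilon>) * t"
      proof (intro mult_right_mono)
        have "4 * e \<le> \<epsilon>" using \<epsilon> m_nonneg by (simp add: e_def divide_le_eq)
        then show "m + 2 * e + \<epsilon> / 2 \<le> m + \<epsilon>" by simp
      qed (use t T in auto)
      finally show ?thesis .
    qed
    then show "w x \<le> (m + \<epsilon>) * ln (1 / norm x)" by (simp add: t_def \<rho>_def)
  qed
qed

end

section \<open>From the n-Laplacian to the normalised operator, and the conclusion\<close>

text \<open>The product rule for |p|^(n-2) p. A nonzero gradient is needed to differentiate its
  norm; since \<open>grad w\<close> is known to equal D only on S, the derivative is transferred on
  that open set.\<close>

lemma n_laplacian_eq_nlap:
  fixes w :: "real^'n \<Rightarrow> real" and H :: "real^'n \<Rightarrow> real^'n \<Rightarrow> real^'n"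
  assumes n: "2 \<le> CARD('n)" and S: "open S" and x: "x \<in> S"
    and gh: "has_grad_hess w D H S"
  shows "grad w x = D x"
    and "D x \<noteq> 0 \<Longrightarrow> n_laplacian w x = norm (D x) ^ (CARD('n) - 2) * nlap (D x) (H x)"
proof -
  have grad: "grad w y = D y" if "y \<in> S" for y
    unfolding grad_def frechet_derivative_at[OF has_grad_hessD(1)[OF gh that], symmetric]
    by (simp add: inner_axis vec_eq_iff)
  then show "grad w x = D x" using x by simp
  assume D0: "D x \<noteq> 0"
  let ?k = "CARD('n) - 2"
  let ?V = "\<lambda>y. (norm (grad w y) ^ ?k) *\<^sub>R grad w y"
  let ?V' = "\<lambda>h. (norm (D x) ^ ?k) *\<^sub>R (H x h + (real ?k * (D x \<bullet> H x h) / (D x \<bullet> D x)) *\<^sub>R D x)"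
  have DD: "(D has_derivative H x) (at x)" by (rule has_grad_hessD(2)[OF gh x])
  have "((\<lambda>y. norm (D y)) has_derivative (\<lambda>h. H x h \<bullet> sgn (D x))) (at x)"
    using has_derivative_compose[OF DD has_derivative_norm[OF D0]] by simp
  then have "((\<lambda>y. norm (D y) ^ ?k) has_derivative
      (\<lambda>h. real ?k * (H x h \<bullet> sgn (D x)) * norm (D x) ^ (?k - 1))) (at x)"
    by (rule has_derivative_power)
  from has_derivative_scaleR[OF this DD]
  have V1: "((\<lambda>y. (norm (D y) ^ ?k) *\<^sub>R D y) has_derivative
      (\<lambda>h. (norm (D x) ^ ?k) *\<^sub>R H x h
         + (real ?k * (H x h \<bullet> sgn (D x)) * norm (D x) ^ (?k - 1)) *\<^sub>R D x)) (at x)" .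
  \<comment> \<open>The exponent \<open>?k - 1\<close> is a truncated difference. For n = 2 it is 0
    instead of -1, but then the factor \<open>real ?k\<close> kills both sides.\<close>
  have eq: "real ?k * (u \<bullet> sgn (D x)) * norm (D x) ^ (?k - 1)
      = norm (D x) ^ ?k * (real ?k * (D x \<bullet> u) / (D x \<bullet> D x))" for u
  proof (cases ?k)
    case (Suc j)
    have "u \<bullet> sgn (D x) = (D x \<bullet> u) / norm (D x)" by (simp add: sgn_div_norm inner_commute divide_inverse)
    moreover have "D x \<bullet> D x = norm (D x) * norm (D x)"
      by (simp add: power2_norm_eq_inner[symmetric] power2_eq_square)
    ultimately show ?thesis using D0 by (simp add: Suc)
  qed simp
  have "((\<lambda>y. (norm (D y) ^ ?k) *\<^sub>R D y) has_derivative ?V') (at x)"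
    using V1 unfolding eq by (simp add: scaleR_add_right)
  then have "(?V has_derivative ?V') (at x)"
    by (rule has_derivative_transform_within_open[OF _ S x]) (simp add: grad)
  then have "frechet_derivative ?V (at x) = ?V'" by (rule frechet_derivative_at[symmetric])
  then have "n_laplacian w x = (\<Sum>i\<in>UNIV. ?V' (axis i 1) $ i)"
    by (simp add: n_laplacian_def divergence_def)
  also have "\<dots> = norm (D x) ^ ?k * ((\<Sum>i\<in>UNIV. H x (axis i 1) $ i)
      + (\<Sum>i\<in>UNIV. real ?k * (D x \<bullet> H x (axis i 1)) / (D x \<bullet> D x) * D x $ i))"
    by (simp add: sum_distrib_left sum.distrib distrib_left)
  also have "(\<Sum>i\<in>UNIV. real ?k * (D x \<bullet> H x (axis i 1)) / (D x \<bullet> D x) * D x $ i)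
      = real ?k * (D x \<bullet> H x (D x)) / (D x \<bullet> D x)"
  proof -
    have lin: "linear (H x)" by (rule has_grad_hess_linear[OF gh x])
    have "D x = (\<Sum>i\<in>UNIV. D x $ i *\<^sub>R axis i 1)"
      by (simp add: basis_expansion[symmetric] scalar_mult_eq_scaleR[symmetric])
    then have "H x (D x) = H x (\<Sum>i\<in>UNIV. D x $ i *\<^sub>R axis i 1)" by simp
    also have "\<dots> = (\<Sum>i\<in>UNIV. D x $ i *\<^sub>R H x (axis i 1))"
      by (simp add: linear_sum[OF lin] linear_cmul[OF lin])
    finally have "D x \<bullet> H x (D x) = (\<Sum>i\<in>UNIV. D x $ i * (D x \<bullet> H x (axis i 1)))"
      by (simp add: inner_sum_right)
    then show ?thesis by (simp add: sum_distrib_left sum_divide_distrib mult_ac)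
  qed
  also have "(\<Sum>i\<in>UNIV. H x (axis i 1) $ i) = (\<Sum>b\<in>Basis. b \<bullet> H x b)"
  proof -
    have *: "(Basis :: (real^'n) set) = (\<lambda>i. axis i 1) ` UNIV" by (auto simp: Basis_vec_def)
    have "inj (\<lambda>i::'n. axis i (1::real))" by (auto simp: inj_on_def axis_eq_axis)
    then show ?thesis unfolding * by (subst sum.reindex) (auto simp: inner_axis')
  qed
  finally show "n_laplacian w x = norm (D x) ^ ?k * nlap (D x) (H x)"
    using n by (simp add: nlap_def of_nat_diff)
qed

theorem theorem1p2:
  fixes w :: "real^'n \<Rightarrow> real"
    and f :: "real^'n \<Rightarrow> real \<Rightarrow> real^'n \<Rightarrow> real"
    and C :: real
  assumes n2: "CARD('n) \<ge> 2"
    and C2: "C2_on (ball 0 2 - {0}) w"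
    and nonneg: "\<forall>x\<in>ball 0 2 - {0}. w x \<ge> 0"
    and eq: "\<forall>x\<in>ball 0 2 - {0}. - n_laplacian w x = f x (w x) (grad w x)"
    and fbound: "\<forall>x\<in>ball 0 2 - {0}. 0 \<le> f x (w x) (grad w x) \<and>
                   f x (w x) (grad w x) \<le> C * norm (grad w x) ^ (CARD('n) - 2) * exp (2 * w x)"
    and blowup: "filterlim w at_top (at 0)"
  shows "\<exists>m\<ge>0. ((\<lambda>x. w x / ln (1 / norm x)) \<longlongrightarrow> m) (at 0) \<and>
           (\<exists>L. \<forall>x\<in>ball 0 1 - {0}. w x \<ge> m * ln (1 / norm x) - L)"
proof -
  let ?S = "ball (0::real^'n) 2 - {0}"
  obtain D H2 where D: "\<And>x. x \<in> ?S \<Longrightarrow> (w has_derivative (\<lambda>h. D x \<bullet> h)) (at x)"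
    "\<And>x. x \<in> ?S \<Longrightarrow> (D has_derivative (\<lambda>h. H2 x *v h)) (at x)"
    using C2 unfolding C2_on_def by blast
  define H where "H = (\<lambda>x h. H2 x *v h)"
  have gh: "has_grad_hess w D H ?S" using D by (auto simp: has_grad_hess_def H_def)
  \<comment> \<open>The common factor |Dw|^(n-2) is positive and cancels from the equation and the
    bound on f. Passing to the absolute value of C supplies the nonnegative constant that the
    rescaling works with.\<close>
  have bounds: "- (\<bar>C\<bar> * exp (2 * w x)) \<le> nlap (D x) (H x) \<and> nlap (D x) (H x) \<le> 0"
    if x: "x \<in> ?S" and D0: "D x \<noteq> 0" for x
  proof -
    define N where "N = norm (D x) ^ (CARD('n) - 2)"
    have N: "0 < N" using D0 by (simp add: N_def)
    have "open ?S" by auto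
    note nl = n_laplacian_eq_nlap[OF n2 this x gh]
    have "0 \<le> N * - nlap (D x) (H x)" "N * - nlap (D x) (H x) \<le> N * (C * exp (2 * w x))"
      using bspec[OF eq x] bspec[OF fbound x] nl(1) nl(2)[OF D0] by (simp_all add: N_def mult_ac)
    then have "0 \<le> - nlap (D x) (H x)" "- nlap (D x) (H x) \<le> C * exp (2 * w x)"
      using N by (simp_all only: zero_le_mult_iff mult_le_cancel_left_pos) simp
    moreover have "C * exp (2 * w x) \<le> \<bar>C\<bar> * exp (2 * w x)" by (intro mult_right_mono) auto
    ultimately show ?thesis by linarith
  qed
  interpret n_superharmonic_punctured w D H
    by unfold_locales (use n2 gh bounds nonneg in auto)
  obtain m where m: "0 \<le> m" "\<And>s t. 0 \<le> s \<Longrightarrow> s \<le> t \<Longrightarrow> min_profile s + m * (t - s) \<le> min_profile t"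
    "\<And>e. 0 < e \<Longrightarrow> \<exists>T\<ge>0. \<forall>s t. T \<le> s \<longrightarrow> s \<le> t \<longrightarrow>
        min_profile t \<le> min_profile s + (m + e) * (t - s)"
  proof (rule concave_asymptotic_slope[of min_profile])
    fix t :: real assume t: "0 \<le> t"
    obtain y where y: "norm y = exp (- t)" "w y = min_profile t" using min_profile(1)[OF t] by blast
    have "y \<noteq> 0" using y(1) by auto
    moreover have "norm y < 2" using y(1) t by (smt (verit) exp_le_one_iff)
    ultimately show "0 \<le> min_profile t" using y(2) nonneg by fastforce
  qed (use min_profile_chord in blast)+
  interpret n_superharmonic_slope w D H m
    by unfold_locales (use m in auto)
  \<comment> \<open>The profile starts at a nonnegative value on the unit sphere and grows with
    slope at least m, so L = 0 is a valid choice.\<close>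
  have lower: "m * ln (1 / norm x) \<le> w x" if x: "x \<in> ball 0 1 - {0}" for x
  proof -
    have x': "x \<noteq> 0" "norm x \<le> 1" "0 \<le> ln (1 / norm x)" using x by (auto simp: ln_div)
    obtain y where y: "norm y = 1" "w y = min_profile 0" using min_profile(1)[of 0] by auto
    have "y \<noteq> 0" using y(1) by auto
    then have "0 \<le> min_profile 0" using nonneg[of y] y by simp
    then show ?thesis using m(2)[of 0 "ln (1 / norm x)"] min_profile_le[of x] x' by simp
  qed
  have large: "\<forall>\<^sub>F x in at (0::real^'n). T \<le> ln (1 / norm x)" for T
  proof -
    have "filterlim (\<lambda>x::real^'n. ln (1 / norm x)) at_top (at 0)"
    proof -
      have "filterlim (\<lambda>x::real^'n. norm x) (at_right 0) (at 0)"
        by (auto simp: filterlim_at eventually_at_filter intro!: tendsto_eq_intros)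
      then have "filterlim (\<lambda>x::real^'n. inverse (norm x)) at_top (at 0)"
        by (rule filterlim_compose[OF filterlim_inverse_at_top_right])
      then show ?thesis using filterlim_compose[OF ln_at_top] by (simp add: inverse_eq_divide)
    qed
    then show ?thesis by (simp add: filterlim_at_top)
  qed
  have "((\<lambda>x. w x / ln (1 / norm x)) \<longlongrightarrow> m) (at 0)"
  proof (rule tendstoI)
    fix \<epsilon> :: real assume \<epsilon>: "0 < \<epsilon>"
    obtain T where T: "\<And>x. x \<noteq> 0 \<Longrightarrow> T \<le> ln (1 / norm x) \<Longrightarrow> w x \<le> (m + \<epsilon> / 2) * ln (1 / norm x)"
      using upper_bound[of "\<bar>C\<bar>" "\<epsilon> / 2"] bounds \<epsilon> by auto
    have "\<forall>\<^sub>F x in at (0::real^'n). x \<noteq> 0 \<and> norm x < 1"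
      by (auto simp: eventually_at intro!: exI[of _ 1])
    with large[of "max T 1"]
    show "\<forall>\<^sub>F x in at 0. dist (w x / ln (1 / norm x)) m < \<epsilon>"
    proof eventually_elim
      case (elim x)
      then have l: "1 \<le> ln (1 / norm x)" and "w x \<le> (m + \<epsilon> / 2) * ln (1 / norm x)"
        "m * ln (1 / norm x) \<le> w x"
        using T[of x] lower[of x] by auto
      then have "m \<le> w x / ln (1 / norm x)" "w x / ln (1 / norm x) \<le> m + \<epsilon> / 2"
        by (simp_all add: pos_le_divide_eq pos_divide_le_eq)
      then show ?case using \<epsilon> by (simp add: dist_real_def)
    qed
  qed
  moreover have "\<forall>x\<in>ball 0 1 - {0}. w x \<ge> m * ln (1 / norm x) - 0" using lower by simp
  ultimately show ?thesis using m(1) by blast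
qed

end
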